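(* Let $\Bbbk$ be an algebraically closed field of characteristic zero, $q\in\Bbbk$ nonzero and not a root of unity, $R=\Bbbk\langle x,y:yx=qxy+1\rangle$, $h=1+(q-1)xy$. Let $e\ge0$ be an integer, $\mu=q^{-e+1}$, and $\sigma$ the automorphism of $R$ with $\sigma(x)=\mu^{-1}x$, $\sigma(y)=\mu y$. Let $a(x)\in\Bbbk[x]$ and $b(y)\in\Bbbk[y]$, not both zero, and let $\delta$ be the $\sigma$-derivation of $R$ given by $\delta(x)=h^{e}b(y)$, $\delta(y)=h^{e}a(x)$. Then the isotropy group $\mathrm{Aut}_\delta^\sigma(R)$ of $\delta$ is isomorphic to $\mathbb Z_d$, where $d$ is the greatest common divisor of all the numbers $k+1$ with $k$ an exponent of a monomial occurring with nonzero coefficient in $a(x)$ or in $b(y)$.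
   Context: All automorphisms are $\Bbbk$-algebra automorphisms. A $\sigma$-derivation of $R$ is a $\Bbbk$-linear map $\delta:R\to R$ with $\delta(ab)=\delta(a)b+\sigma(a)\delta(b)$ for all $a,b\in R$; it is determined by its values on $x,y$. Since $q$ is not a root of unity, every automorphism of $R$ has the form $\rho(x)=\beta^{-1}x$, $\rho(y)=\beta y$, $\beta\in\Bbbk^*$ (known fact); all commute with $\sigma$. The isotropy group is $\mathrm{Aut}_\delta^\sigma(R)=\{\rho\in\mathrm{Aut}(R):\rho\delta=\delta\rho\}$. $\mathbb Z_d$ is the cyclic group of order $d$ (trivial for $d=1$). *)

theory Defs
  imports
    "HOL-Algebra.Algebra"
    "HOL-Algebra.Algebraic_Closure_Type"
    "HOL-Library.Poly_Mapping"
    "HOL-Computational_Algebra.Computational_Algebra"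
begin

text \<open>
  The free associative algebra on two letters is the monoid algebra of the free monoid on these
  letters: with concatenation of words written additively, this is the ring of finitely supported
  functions \<open>word \<Rightarrow>\<^sub>0 'k\<close> with convolution as multiplication.
\<close>

datatype letter = Letter_x | Letter_y

datatype word = Word (letters: "letter list")

instantiation word :: monoid_add
begin

definition "0 = Word []"

definition "u + v = Word (letters u @ letters v)"

instance
  by standard (simp_all add: zero_word_def plus_word_def)

end

type_synonym 'k free_algebra = "word \<Rightarrow>\<^sub>0 'k"

definition free_x :: "'k::field free_algebra"
  where "free_x = Poly_Mapping.single (Word [Letter_x]) 1"

definition free_y :: "'k::field free_algebra"
  where "free_y = Poly_Mapping.single (Word [Letter_y]) 1"

definition free_scalar :: "'k::field \<Rightarrow> 'k free_algebra"
  where "free_scalar c = Poly_Mapping.single 0 c"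

definition weyl_ideal :: "'k::field \<Rightarrow> 'k free_algebra set"
  where "weyl_ideal q =
    Idl\<^bsub>ring_of_type_algebra\<^esub> {free_y * free_x - (free_scalar q * free_x * free_y + 1)}"

definition qweyl :: "'k::field \<Rightarrow> 'k free_algebra set ring"
  where "qweyl q = ring_of_type_algebra Quot (weyl_ideal q)"

definition weyl_proj :: "'k::field \<Rightarrow> 'k free_algebra \<Rightarrow> 'k free_algebra set"
  where "weyl_proj q f = weyl_ideal q +>\<^bsub>ring_of_type_algebra\<^esub> f"

definition weyl_x :: "'k::field \<Rightarrow> 'k free_algebra set"
  where "weyl_x q = weyl_proj q free_x"

definition weyl_y :: "'k::field \<Rightarrow> 'k free_algebra set"
  where "weyl_y q = weyl_proj q free_y"

definition weyl_smult :: "'k::field \<Rightarrow> 'k \<Rightarrow> 'k free_algebra set \<Rightarrow> 'k free_algebra set"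
  where "weyl_smult q c r = weyl_proj q (free_scalar c) \<otimes>\<^bsub>qweyl q\<^esub> r"

definition weyl_h :: "'k::field \<Rightarrow> 'k free_algebra set"
  where "weyl_h q = \<one>\<^bsub>qweyl q\<^esub> \<oplus>\<^bsub>qweyl q\<^esub> weyl_smult q (q - 1) (weyl_x q \<otimes>\<^bsub>qweyl q\<^esub> weyl_y q)"

definition weyl_eval :: "'k::field \<Rightarrow> 'k poly \<Rightarrow> 'k free_algebra set \<Rightarrow> 'k free_algebra set"
  where "weyl_eval q p r =
    (\<Oplus>\<^bsub>qweyl q\<^esub>i\<in>{..Polynomial.degree p}.
      weyl_smult q (Polynomial.coeff p i) (r [^]\<^bsub>qweyl q\<^esub> i))"

definition weyl_linear :: "'k::field \<Rightarrow> ('k free_algebra set \<Rightarrow> 'k free_algebra set) \<Rightarrow> bool"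
  where "weyl_linear q f \<longleftrightarrow>
    f \<in> carrier (qweyl q) \<rightarrow> carrier (qweyl q) \<and>
    (\<forall>r\<in>carrier (qweyl q). \<forall>s\<in>carrier (qweyl q).
      f (r \<oplus>\<^bsub>qweyl q\<^esub> s) = f r \<oplus>\<^bsub>qweyl q\<^esub> f s) \<and>
    (\<forall>c. \<forall>r\<in>carrier (qweyl q). f (weyl_smult q c r) = weyl_smult q c (f r))"

text \<open>
  As in \<^const>\<open>Bij\<close>, automorphisms are taken to be extensional functions, so that two of them
  are equal as soon as they agree on the carrier.
\<close>

definition weyl_Aut :: "'k::field \<Rightarrow> ('k free_algebra set \<Rightarrow> 'k free_algebra set) set"
  where "weyl_Aut q =
    {\<rho> \<in> Bij (carrier (qweyl q)). \<rho> \<in> ring_hom (qweyl q) (qweyl q) \<and> weyl_linear q \<rho>}"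

definition weyl_derivation ::
  "'k::field \<Rightarrow> ('k free_algebra set \<Rightarrow> 'k free_algebra set) \<Rightarrow>
    ('k free_algebra set \<Rightarrow> 'k free_algebra set) \<Rightarrow> bool"
  where "weyl_derivation q \<sigma> \<delta> \<longleftrightarrow>
    weyl_linear q \<delta> \<and>
    (\<forall>r\<in>carrier (qweyl q). \<forall>s\<in>carrier (qweyl q).
      \<delta> (r \<otimes>\<^bsub>qweyl q\<^esub> s) =
        \<delta> r \<otimes>\<^bsub>qweyl q\<^esub> s \<oplus>\<^bsub>qweyl q\<^esub> \<sigma> r \<otimes>\<^bsub>qweyl q\<^esub> \<delta> s)"

definition isotropy_group ::
  "'k::field \<Rightarrow> ('k free_algebra set \<Rightarrow> 'k free_algebra set) \<Rightarrow>
    ('k free_algebra set \<Rightarrow> 'k free_algebra set) monoid"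
  where "isotropy_group q \<delta> =
    BijGroup (carrier (qweyl q))
      \<lparr>carrier := {\<rho> \<in> weyl_Aut q. \<forall>r\<in>carrier (qweyl q). \<rho> (\<delta> r) = \<delta> (\<rho> r)}\<rparr>"

lemma ring_of_ring_1: "ring (ring_of_type_algebra :: 'a::ring_1 ring)"
proof -
  have "\<exists>y. x + y = 0" for x :: 'a
    using add.right_inverse by blast
  then show ?thesis
    unfolding ring_of_type_algebra_def using add.right_inverse
    by unfold_locales (auto simp: algebra_simps Units_def)
qed

lemma ideal_weyl_ideal: "ideal (weyl_ideal q) ring_of_type_algebra"
  unfolding weyl_ideal_def
  by (rule ring.genideal_ideal[OF ring_of_ring_1]) (simp add: ring_of_type_algebra_def)

lemma ring_qweyl: "ring (qweyl q)"
  unfolding qweyl_def by (rule ideal.quotient_is_ring[OF ideal_weyl_ideal])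

lemma weyl_proj_ring_hom: "weyl_proj q \<in> ring_hom ring_of_type_algebra (qweyl q)"
  using ideal.rcos_ring_hom[OF ideal_weyl_ideal[of q]]
  by (simp add: weyl_proj_def[abs_def] qweyl_def)

lemma weyl_proj_closed [simp]: "weyl_proj q f \<in> carrier (qweyl q)"
  using ring_hom_closed[OF weyl_proj_ring_hom] by (simp add: ring_of_type_algebra_def)

lemma weyl_proj_mult:
  "weyl_proj q (f * g) = weyl_proj q f \<otimes>\<^bsub>qweyl q\<^esub> weyl_proj q g"
  using ring_hom_mult[OF weyl_proj_ring_hom, of f g] by (simp add: ring_of_type_algebra_def)

lemma weyl_proj_add:
  "weyl_proj q (f + g) = weyl_proj q f \<oplus>\<^bsub>qweyl q\<^esub> weyl_proj q g"
  using ring_hom_add[OF weyl_proj_ring_hom, of f g] by (simp add: ring_of_type_algebra_def)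

lemma weyl_proj_one: "weyl_proj q 1 = \<one>\<^bsub>qweyl q\<^esub>"
  using ring_hom_one[OF weyl_proj_ring_hom] by (simp add: ring_of_type_algebra_def)

lemma weyl_relation:
  "weyl_y q \<otimes>\<^bsub>qweyl q\<^esub> weyl_x q =
    weyl_smult q q (weyl_x q \<otimes>\<^bsub>qweyl q\<^esub> weyl_y q) \<oplus>\<^bsub>qweyl q\<^esub> \<one>\<^bsub>qweyl q\<^esub>"
proof -
  let ?F = "ring_of_type_algebra :: 'a free_algebra ring"
  let ?g = "free_y * free_x - (free_scalar q * free_x * free_y + 1) :: 'a free_algebra"
  interpret F: ring ?F by (rule ring_of_ring_1)
  interpret I: ideal "weyl_ideal q" ?F by (rule ideal_weyl_ideal)
  interpret Q: ring "qweyl q" by (rule ring_qweyl)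
  have "?g \<in> weyl_ideal q"
    unfolding weyl_ideal_def by (rule F.genideal_self') (simp add: ring_of_type_algebra_def)
  then have "weyl_proj q ?g = \<zero>\<^bsub>qweyl q\<^esub>"
    unfolding weyl_proj_def qweyl_def FactRing_def by (simp add: I.a_rcos_const)
  moreover have "weyl_proj q (free_y * free_x) =
      weyl_proj q (?g + (free_scalar q * free_x * free_y + 1))"
    by simp
  ultimately show ?thesis
    unfolding weyl_x_def weyl_y_def weyl_smult_def
    by (simp only: weyl_proj_mult weyl_proj_add weyl_proj_one Q.m_assoc weyl_proj_closed
        Q.l_zero Q.m_closed Q.a_closed Q.one_closed)
qed

end

theory Submission
  imports Defs
begin

text \<open>
  The algebra \<open>R\<close> acts on two-sided sequences \<open>u\<close> by \<open>(y u)\<^sub>j = u\<^bsub>j+1\<^esub>\<close> and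
  \<open>(x u)\<^sub>j = [j] u\<^bsub>j-1\<^esub>\<close> with \<open>[j] = (q\<^sup>j - 1) / (q - 1)\<close>; then \<open>h = y x - x y\<close> acts diagonally by
  \<open>(h u)\<^sub>j = q\<^sup>j u\<^sub>j\<close>. As \<open>q\<close> is not a root of unity, the monomials \<open>x\<^sup>i y\<^sup>j\<close>, which span \<open>R\<close>, act
  linearly independently, so the action is faithful. An element acts by
  \<open>(A u)\<^sub>j = (\<Sum>k. F\<^sub>k(q\<^sup>j) u\<^bsub>j+k\<^esub>)\<close> with finitely many polynomials \<open>F\<^sub>k\<close>, its symbol.

  Commutators of \<open>R\<close> lie in the two-sided ideal \<open>h R\<close>, so an automorphism \<open>\<rho>\<close> maps \<open>h\<close> to \<open>h\<close> times a
  unit. Comparing extreme symbols shows that units are scalars, hence \<open>\<rho>(h) = c h\<close> and \<open>\<rho>\<close> preserves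
  the eigenspaces of conjugation by \<open>h\<close>. Comparing degrees in \<open>c h = 1 + (q - 1) \<rho>(x) \<rho>(y)\<close> leaves
  only \<open>\<rho>(x) = \<beta>\<^sup>-\<^sup>1 x\<close> and \<open>\<rho>(y) = \<beta> y\<close>. Such a \<open>\<rho>\<close> is conjugation by a diagonal operator and fixes
  \<open>h\<close>; it commutes with \<open>\<delta>\<close> on the generators iff \<open>\<beta>\<^bsup>k+1\<^esup> = 1\<close> for all relevant \<open>k\<close>, that is, iff
  \<open>\<beta>\<^sup>d = 1\<close>.
\<close>

section \<open>Operators on two-sided sequences\<close>

text \<open>Linear endomorphisms of the space of all two-sided sequences, bundled as a type so that
  composition gives an instance of \<open>ring_1\<close> and identities can be checked position by
  position.\<close>

typedef (overloaded) 'k seq_op =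
  "{f :: (int \<Rightarrow> 'k::field) \<Rightarrow> int \<Rightarrow> 'k.
     (\<forall>u v. f (\<lambda>j. u j + v j) = (\<lambda>j. f u j + f v j)) \<and>
     (\<forall>c u. f (\<lambda>j. c * u j) = (\<lambda>j. c * f u j))}"
  morphisms seq_apply Abs_seq_op
  by (rule exI[of _ "\<lambda>u. u"]) simp

setup_lifting type_definition_seq_op

lemma seq_op_eqI: "(\<And>u j. seq_apply A u j = seq_apply B u j) \<Longrightarrow> A = B"
  by (metis ext seq_apply_inject)

instantiation seq_op :: (field) ring_1
begin

lift_definition zero_seq_op :: "'a seq_op" is "\<lambda>u j. 0" by simp
lift_definition one_seq_op :: "'a seq_op" is "\<lambda>u. u" by simp
lift_definition plus_seq_op :: "'a seq_op \<Rightarrow> 'a seq_op \<Rightarrow> 'a seq_op"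
  is "\<lambda>f g u j. f u j + g u j" by (auto simp: algebra_simps)
lift_definition minus_seq_op :: "'a seq_op \<Rightarrow> 'a seq_op \<Rightarrow> 'a seq_op"
  is "\<lambda>f g u j. f u j - g u j" by (auto simp: algebra_simps)
lift_definition uminus_seq_op :: "'a seq_op \<Rightarrow> 'a seq_op"
  is "\<lambda>f u j. - f u j" by auto
lift_definition times_seq_op :: "'a seq_op \<Rightarrow> 'a seq_op \<Rightarrow> 'a seq_op"
  is "\<lambda>f g u. f (g u)" by auto

instance
proof
  fix a b c :: "'a seq_op"
  show "a + b + c = a + (b + c)" by transfer (simp add: add.assoc)
  show "a + b = b + a" by transfer (simp add: add.commute)
  show "0 + a = a" by transfer simp
  show "- a + a = 0" by transfer simp
  show "a - b = a + - b" by transfer simp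
  show "a * b * c = a * (b * c)" by transfer simp
  show "1 * a = a" by transfer simp
  show "a * 1 = a" by transfer simp
  show "(a + b) * c = a * c + b * c" by transfer simp
  show "a * (b + c) = a * b + a * c" by transfer simp
  show "(0 :: 'a seq_op) \<noteq> 1"
  proof
    assume "(0 :: 'a seq_op) = 1"
    then have "(\<lambda>(u :: int \<Rightarrow> 'a) (j :: int). 0) = (\<lambda>u. u)"
      by transfer
    then have "(0 :: 'a) = 1"
      by (rule fun_cong[OF fun_cong[of _ _ "\<lambda>_. 1 :: 'a"]])
    then show False by simp
  qed
qed

end

lift_definition scalar_op :: "'k::field \<Rightarrow> 'k seq_op" is "\<lambda>c u j. c * u j"
  by (auto simp: algebra_simps)

lift_definition raise_op :: "'k::field \<Rightarrow> 'k seq_op"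
  is "\<lambda>q u j. (q powi j - 1) / (q - 1) * u (j - 1)"
  by (auto simp: distrib_left mult.left_commute)

lift_definition shift_op :: "'k::field seq_op" is "\<lambda>u j. u (j + 1)"
  by auto

text \<open>For \<open>c = q\<close> this is the action of h. For other c it need not be the action
  of an element of R; it then serves for conjugation in \<open>conj_op\<close>.\<close>

lift_definition diag_op :: "'k::field \<Rightarrow> 'k seq_op" is "\<lambda>c u j. c powi j * u j"
  by (auto simp: algebra_simps)

lemma seq_apply_simps [simp]:
  "seq_apply 0 u j = 0"
  "seq_apply 1 u = u"
  "seq_apply (A + B) u j = seq_apply A u j + seq_apply B u j"
  "seq_apply (A - B) u j = seq_apply A u j - seq_apply B u j"
  "seq_apply (- A) u j = - seq_apply A u j"
  "seq_apply (A * B) u = seq_apply A (seq_apply B u)"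
  "seq_apply (scalar_op c) u j = c * u j"
  "seq_apply (raise_op q) u j = (q powi j - 1) / (q - 1) * u (j - 1)"
  "seq_apply shift_op u j = u (j + 1)"
  "seq_apply (diag_op c) u j = c powi j * u j"
  by (simp_all add: zero_seq_op.rep_eq one_seq_op.rep_eq plus_seq_op.rep_eq minus_seq_op.rep_eq
      uminus_seq_op.rep_eq times_seq_op.rep_eq scalar_op.rep_eq raise_op.rep_eq shift_op.rep_eq
      diag_op.rep_eq)

lemma seq_apply_scale: "seq_apply A (\<lambda>j. c * u j) = (\<lambda>j. c * seq_apply A u j)"
  by transfer simp

lemma scalar_op_commute: "scalar_op c * A = A * scalar_op c"
proof (rule seq_op_eqI)
  fix u j
  have "seq_apply (scalar_op c) u = (\<lambda>j. c * u j)" by auto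
  then show "seq_apply (scalar_op c * A) u j = seq_apply (A * scalar_op c) u j"
    by (simp add: seq_apply_scale)
qed

lemma scalar_op_add: "scalar_op (a + b) = scalar_op a + scalar_op b"
  and scalar_op_mult: "scalar_op (a * b) = scalar_op a * scalar_op b"
  and scalar_op_0 [simp]: "scalar_op 0 = 0"
  and scalar_op_1 [simp]: "scalar_op 1 = 1"
  by (rule seq_op_eqI; simp add: algebra_simps)+

lemma seq_apply_sum: "seq_apply (sum f I) u j = (\<Sum>i\<in>I. seq_apply (f i) u j)"
  by (induction I rule: infinite_finite_induct) auto

section \<open>Linear extension from words to the free algebra\<close>

definition lin_ext :: "('a \<Rightarrow> 'b::comm_monoid_add \<Rightarrow> 'c::comm_monoid_add) \<Rightarrow> ('a \<Rightarrow>\<^sub>0 'b) \<Rightarrow> 'c"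
  where "lin_ext \<phi> f = (\<Sum>k\<in>Poly_Mapping.keys f. \<phi> k (Poly_Mapping.lookup f k))"

text \<open>Keys outside the support contribute \<open>\<phi> k 0 = 0\<close>; this allows two
  elements to be summed over the union of their supports.\<close>

lemma lin_ext_superset:
  assumes "\<And>k. \<phi> k 0 = 0" "finite K" "Poly_Mapping.keys f \<subseteq> K"
  shows "lin_ext \<phi> f = (\<Sum>k\<in>K. \<phi> k (Poly_Mapping.lookup f k))"
  unfolding lin_ext_def using assms
  by (intro sum.mono_neutral_left) (auto simp: in_keys_iff)

lemma lin_ext_add:
  assumes "\<And>k. \<phi> k 0 = 0" "\<And>k c d. \<phi> k (c + d) = \<phi> k c + \<phi> k d"
  shows "lin_ext \<phi> (f + g) = lin_ext \<phi> f + lin_ext \<phi> g"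
proof -
  let ?K = "Poly_Mapping.keys f \<union> Poly_Mapping.keys g"
  have "lin_ext \<phi> (f + g) = (\<Sum>k\<in>?K. \<phi> k (Poly_Mapping.lookup (f + g) k))"
    by (rule lin_ext_superset) (auto simp: assms Poly_Mapping.keys_add)
  also have "\<dots> = (\<Sum>k\<in>?K. \<phi> k (Poly_Mapping.lookup f k)) + (\<Sum>k\<in>?K. \<phi> k (Poly_Mapping.lookup g k))"
    by (simp add: lookup_add assms sum.distrib)
  also have "\<dots> = lin_ext \<phi> f + lin_ext \<phi> g"
    using lin_ext_superset[of \<phi> ?K f] lin_ext_superset[of \<phi> ?K g] by (simp add: assms)
  finally show ?thesis .
qed

lemma lin_ext_single:
  assumes "\<And>k. \<phi> k 0 = 0"
  shows "lin_ext \<phi> (Poly_Mapping.single k c) = \<phi> k c"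
  by (subst lin_ext_superset[of _ "{k}"]) (auto simp: assms)

text \<open>Inserting a fresh key is the addition of a single term, so additive statements need
  checking on single terms only.\<close>

lemma poly_mapping_additive_induct [case_names zero single add]:
  assumes "P 0" "\<And>k c. P (Poly_Mapping.single k c)" "\<And>f g. P f \<Longrightarrow> P g \<Longrightarrow> P (f + g)"
  shows "P (f :: 'a \<Rightarrow>\<^sub>0 'b::comm_monoid_add)"
proof (induction f rule: update_induct)
  case const
  then show ?case using assms(1) .
next
  case (update f a b)
  have "Poly_Mapping.update a b f = f + Poly_Mapping.single a b"
    using update by (intro poly_mapping_eqI)
      (auto simp: lookup_update lookup_add lookup_single in_keys_iff)
  then show ?case using update assms by auto
qed

fun letter_op :: "'k::field \<Rightarrow> letter \<Rightarrow> 'k seq_op"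
  where "letter_op q Letter_x = raise_op q" | "letter_op q Letter_y = shift_op"

definition word_op :: "'k::field \<Rightarrow> word \<Rightarrow> 'k seq_op"
  where "word_op q w = prod_list (map (letter_op q) (letters w))"

definition weyl_rep :: "'k::field \<Rightarrow> 'k free_algebra \<Rightarrow> 'k seq_op"
  where "weyl_rep q = lin_ext (\<lambda>w c. scalar_op c * word_op q w)"

lemma word_op_add: "word_op q (v + w) = word_op q v * word_op q w"
  by (simp add: word_op_def plus_word_def)

lemma word_op_0 [simp]: "word_op q 0 = 1"
  by (simp add: word_op_def zero_word_def)

lemma weyl_rep_add: "weyl_rep q (f + g) = weyl_rep q f + weyl_rep q g"
  unfolding weyl_rep_def by (rule lin_ext_add) (auto simp: scalar_op_add algebra_simps)

lemma weyl_rep_single: "weyl_rep q (Poly_Mapping.single w c) = scalar_op c * word_op q w"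
  unfolding weyl_rep_def by (rule lin_ext_single) auto

lemma weyl_rep_0 [simp]: "weyl_rep q 0 = 0"
  by (simp add: weyl_rep_def lin_ext_def)

lemma weyl_rep_diff: "weyl_rep q (f - g) = weyl_rep q f - weyl_rep q g"
  using weyl_rep_add[of q "f - g" g] by (simp add: algebra_simps)

lemma weyl_rep_minus: "weyl_rep q (- f) = - weyl_rep q f"
  using weyl_rep_diff[of q 0 f] by simp

text \<open>Additivity in both arguments reduces this to single words, where concatenation becomes
  composition and the coefficients, acting centrally, can be collected in front.\<close>

lemma weyl_rep_mult: "weyl_rep q (f * g) = weyl_rep q f * weyl_rep q g"
proof (induction f rule: poly_mapping_additive_induct)
  case (single v c)
  show ?case
  proof (induction g rule: poly_mapping_additive_induct)
    case (single w d)
    have "scalar_op c * word_op q v * (scalar_op d * word_op q w) =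
        scalar_op c * (word_op q v * scalar_op d) * word_op q w"
      by (simp only: mult.assoc)
    also have "\<dots> = scalar_op c * scalar_op d * (word_op q v * word_op q w)"
      by (simp only: scalar_op_commute[of d "word_op q v", symmetric] mult.assoc)
    also have "\<dots> = scalar_op (c * d) * word_op q (v + w)"
      by (simp only: scalar_op_mult word_op_add)
    finally show ?case
      by (simp only: mult_single weyl_rep_single)
  qed (simp_all add: weyl_rep_add distrib_left distrib_right)
qed (simp_all add: weyl_rep_add distrib_left distrib_right)

lemma weyl_rep_gens [simp]:
  "weyl_rep q 1 = 1"
  "weyl_rep q free_x = raise_op q"
  "weyl_rep q free_y = shift_op"
  "weyl_rep q (free_scalar c) = scalar_op c"
proof -
  show "weyl_rep q 1 = 1"
    using weyl_rep_single[of q 0 1] by (simp only: single_one scalar_op_1 word_op_0 mult_1_left)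
qed (simp_all add: free_x_def free_y_def free_scalar_def weyl_rep_single word_op_def zero_word_def)

lemma free_scalar_commute: "free_scalar c * f = f * free_scalar c"
proof (induction f rule: poly_mapping_additive_induct)
  case (single w d)
  then show ?case by (simp add: free_scalar_def mult_single mult.commute[of c])
qed (simp_all add: distrib_left distrib_right)

lemma free_scalar_add: "free_scalar (a + b) = free_scalar a + free_scalar b"
  and free_scalar_mult: "free_scalar (a * b) = free_scalar a * free_scalar b"
  and free_scalar_0 [simp]: "free_scalar 0 = 0"
  and free_scalar_1 [simp]: "free_scalar 1 = 1"
  by (simp_all add: free_scalar_def single_add mult_single)

section \<open>Faithfulness of the representation\<close>

lemma weyl_ideal_closed:
  shows weyl_ideal_0 [simp]: "0 \<in> weyl_ideal q"
    and weyl_ideal_add: "f \<in> weyl_ideal q \<Longrightarrow> g \<in> weyl_ideal q \<Longrightarrow> f + g \<in> weyl_ideal q"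
    and weyl_ideal_lmult: "f \<in> weyl_ideal q \<Longrightarrow> g * f \<in> weyl_ideal q"
    and weyl_ideal_rmult: "f \<in> weyl_ideal q \<Longrightarrow> f * g \<in> weyl_ideal q"
proof -
  let ?F = "ring_of_type_algebra :: 'a free_algebra ring"
  interpret I: ideal "weyl_ideal q" ?F by (rule ideal_weyl_ideal)
  show "0 \<in> weyl_ideal q"
    using additive_subgroup.zero_closed[OF I.additive_subgroup_axioms]
    by (simp add: ring_of_type_algebra_def)
  show "f \<in> weyl_ideal q \<Longrightarrow> g \<in> weyl_ideal q \<Longrightarrow> f + g \<in> weyl_ideal q"
    using additive_subgroup.a_closed[OF I.additive_subgroup_axioms]
    by (simp add: ring_of_type_algebra_def)
  show "f \<in> weyl_ideal q \<Longrightarrow> g * f \<in> weyl_ideal q" "f \<in> weyl_ideal q \<Longrightarrow> f * g \<in> weyl_ideal q"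
    using I.I_l_closed[of f g] I.I_r_closed[of f g] by (simp_all add: ring_of_type_algebra_def)
qed

lemma weyl_ideal_relation:
  "free_y * free_x - (free_scalar q * free_x * free_y + 1) \<in> weyl_ideal q"
  unfolding weyl_ideal_def
  by (rule ring.genideal_self'[OF ring_of_ring_1]) (simp add: ring_of_type_algebra_def)

lemma weyl_proj_eq_0_iff: "weyl_proj q f = \<zero>\<^bsub>qweyl q\<^esub> \<longleftrightarrow> f \<in> weyl_ideal q"
proof -
  let ?F = "ring_of_type_algebra :: 'a free_algebra ring"
  interpret F: ring ?F by (rule ring_of_ring_1)
  interpret I: ideal "weyl_ideal q" ?F by (rule ideal_weyl_ideal)
  have "f \<in> carrier ?F" by (simp add: ring_of_type_algebra_def)
  then show ?thesis
    unfolding weyl_proj_def qweyl_def FactRing_def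
    using I.a_rcos_const I.a_rcos_self by auto
qed

lemma weyl_proj_0: "weyl_proj q 0 = \<zero>\<^bsub>qweyl q\<^esub>"
  by (simp add: weyl_proj_eq_0_iff)

lemma weyl_proj_minus: "weyl_proj q (- f) = \<ominus>\<^bsub>qweyl q\<^esub> weyl_proj q f"
proof -
  interpret Q: ring "qweyl q" by (rule ring_qweyl)
  have "weyl_proj q (- f) \<oplus>\<^bsub>qweyl q\<^esub> weyl_proj q f = \<zero>\<^bsub>qweyl q\<^esub>"
    by (simp add: weyl_proj_add[symmetric] weyl_proj_0)
  then show ?thesis
    by (metis Q.minus_equality weyl_proj_closed)
qed

lemma weyl_proj_eq_iff: "weyl_proj q f = weyl_proj q g \<longleftrightarrow> f - g \<in> weyl_ideal q"
proof -
  interpret Q: ring "qweyl q" by (rule ring_qweyl)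
  have "weyl_proj q (f - g) = weyl_proj q f \<ominus>\<^bsub>qweyl q\<^esub> weyl_proj q g"
    using weyl_proj_add[of q f "- g"] by (simp add: weyl_proj_minus a_minus_def)
  then show ?thesis
    using weyl_proj_eq_0_iff[of q "f - g"] Q.r_right_minus_eq by simp
qed

lemma carrier_qweylE:
  assumes "r \<in> carrier (qweyl q)"
  obtains f where "r = weyl_proj q f"
  using assms unfolding qweyl_def weyl_proj_def FactRing_def A_RCOSETS_def'
  by auto

section \<open>Spanning by the ordered monomials \<open>x ^ i * y ^ j\<close>
  (Poincare-Birkhoff-Witt basis)\<close>

definition pbw_sum :: "(nat \<times> nat \<Rightarrow>\<^sub>0 'k::field) \<Rightarrow> 'k free_algebra"
  where "pbw_sum = lin_ext (\<lambda>(i, j) c. free_scalar c * free_x ^ i * free_y ^ j)"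

lemma pbw_sum_0 [simp]: "pbw_sum 0 = 0"
  by (simp add: pbw_sum_def lin_ext_def)

lemma pbw_sum_add: "pbw_sum (c + d) = pbw_sum c + pbw_sum d"
  unfolding pbw_sum_def by (rule lin_ext_add) (auto simp: free_scalar_add distrib_right)

lemma pbw_sum_single:
  "pbw_sum (Poly_Mapping.single (i, j) c) = free_scalar c * free_x ^ i * free_y ^ j"
  unfolding pbw_sum_def by (subst lin_ext_single) auto

text \<open>A skew Leibniz rule: moving y past a power of x leaves its q-derivative
  \<open>[i] x ^ (i - 1)\<close>. For \<open>i = 0\<close> the sum of powers of q is empty, so the
  truncated exponent does no harm.\<close>

lemma weyl_ideal_y_x_power:
  "free_y * free_x ^ i - (free_scalar (q ^ i) * free_x ^ i * free_y
    + free_scalar (\<Sum>l<i. q ^ l) * free_x ^ (i - 1)) \<in> weyl_ideal q"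
proof (induction i)
  case (Suc i)
  let ?x = "free_x :: 'a free_algebra" and ?y = "free_y :: 'a free_algebra"
  let ?S = "free_scalar (\<Sum>l<i. q ^ l)" and ?q = "free_scalar (q ^ i)"
  have S: "?S * ?x ^ (i - 1) * ?x = ?S * ?x ^ i"
    by (cases i) (simp_all add: mult.assoc power_commutes)
  \<comment> \<open>The induction hypothesis times x on the right, plus a left multiple of the
    defining relation.\<close>
  have "(?y * ?x ^ i - (?q * ?x ^ i * ?y + ?S * ?x ^ (i - 1))) * ?x
      + ?q * ?x ^ i * (?y * ?x - (free_scalar q * ?x * ?y + 1)) \<in> weyl_ideal q"
    by (intro weyl_ideal_add weyl_ideal_rmult weyl_ideal_lmult Suc weyl_ideal_relation)
  also have "(?y * ?x ^ i - (?q * ?x ^ i * ?y + ?S * ?x ^ (i - 1))) * ?x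
      + ?q * ?x ^ i * (?y * ?x - (free_scalar q * ?x * ?y + 1))
    = ?y * (?x ^ i * ?x) - (?q * (?x ^ i * free_scalar q) * ?x * ?y + (?q * ?x ^ i + ?S * ?x ^ (i - 1) * ?x))"
    by (simp add: algebra_simps)
  also have "?q * (?x ^ i * free_scalar q) * ?x * ?y = free_scalar (q ^ Suc i) * ?x ^ Suc i * ?y"
    unfolding free_scalar_commute[of q "?x ^ i", symmetric]
    by (simp only: power_Suc2 free_scalar_mult mult.assoc)
  also have "?q * ?x ^ i + ?S * ?x ^ (i - 1) * ?x = free_scalar (\<Sum>l<Suc i. q ^ l) * ?x ^ (Suc i - 1)"
    unfolding S by (simp add: free_scalar_add distrib_right add.commute)
  also have "?x ^ i * ?x = ?x ^ Suc i"
    by (simp only: power_Suc2)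
  finally show ?case .
qed simp

text \<open>Left multiplication by x keeps monomials ordered, so here equality holds already in the
  free algebra.\<close>

lemma pbw_spanning_x: "\<exists>c'. free_x * pbw_sum c = pbw_sum c'"
proof (induction c rule: poly_mapping_additive_induct)
  case zero
  show ?case by (intro exI[of _ 0]) simp
next
  case (single k c)
  obtain i j where k: "k = (i, j)" by force
  have "free_x * pbw_sum (Poly_Mapping.single k c) = pbw_sum (Poly_Mapping.single (Suc i, j) c)"
    by (simp add: k pbw_sum_single mult.assoc[symmetric] free_scalar_commute[of c free_x])
  then show ?case ..
next
  case (add f g)
  then show ?case by (metis distrib_left pbw_sum_add)
qed

text \<open>Reordering by \<open>weyl_ideal_y_x_power\<close> turns one monomial into two, and is
  valid only modulo the ideal.\<close>

lemma pbw_spanning_y: "\<exists>c'. free_y * pbw_sum c - pbw_sum c' \<in> weyl_ideal q"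
proof (induction c rule: poly_mapping_additive_induct)
  case zero
  show ?case by (intro exI[of _ 0]) simp
next
  case (single k c)
  obtain i j where k: "k = (i, j)" by force
  let ?x = "free_x :: 'a free_algebra" and ?y = "free_y :: 'a free_algebra"
  let ?S = "\<Sum>l<i. q ^ l"
  have "free_scalar c * (?y * ?x ^ i - (free_scalar (q ^ i) * ?x ^ i * ?y
      + free_scalar ?S * ?x ^ (i - 1))) * ?y ^ j \<in> weyl_ideal q"
    by (intro weyl_ideal_rmult weyl_ideal_lmult weyl_ideal_y_x_power)
  also have "free_scalar c * (?y * ?x ^ i - (free_scalar (q ^ i) * ?x ^ i * ?y
      + free_scalar ?S * ?x ^ (i - 1))) * ?y ^ j
    = ?y * pbw_sum (Poly_Mapping.single k c) - pbw_sum (Poly_Mapping.single (i, Suc j) (c * q ^ i)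
      + Poly_Mapping.single (i - 1, j) (c * ?S))"
    by (simp add: k pbw_sum_single pbw_sum_add mult.assoc[symmetric] free_scalar_commute[of c ?y, symmetric]
       left_diff_distrib right_diff_distrib distrib_left distrib_right free_scalar_mult)
  finally show ?case by blast
next
  case (add f g)
  then obtain c d where "free_y * pbw_sum f - pbw_sum c \<in> weyl_ideal q"
    "free_y * pbw_sum g - pbw_sum d \<in> weyl_ideal q" by blast
  then have "(free_y * pbw_sum f - pbw_sum c) + (free_y * pbw_sum g - pbw_sum d) \<in> weyl_ideal q"
    by (rule weyl_ideal_add)
  then have "free_y * pbw_sum (f + g) - pbw_sum (c + d) \<in> weyl_ideal q"
    by (simp add: pbw_sum_add distrib_left algebra_simps)
  then show ?case ..
qed

text \<open>A word is built by adding letters on the left, and each such multiplication preserves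
  the span of the ordered monomials modulo the ideal.\<close>

lemma pbw_spanning: "\<exists>c. f - pbw_sum c \<in> weyl_ideal q"
proof (induction f rule: poly_mapping_additive_induct)
  case zero
  show ?case by (intro exI[of _ 0]) simp
next
  case (single w a)
  have "\<exists>c. Poly_Mapping.single (Word ls) a - pbw_sum c \<in> weyl_ideal q" for ls
  proof (induction ls)
    case Nil
    show ?case
      by (rule exI[of _ "Poly_Mapping.single (0, 0) a"])
        (simp add: pbw_sum_single free_scalar_def zero_word_def)
  next
    case (Cons l ls)
    then obtain c where c: "Poly_Mapping.single (Word ls) a - pbw_sum c \<in> weyl_ideal q" by blast
    let ?g = "case l of Letter_x \<Rightarrow> free_x | Letter_y \<Rightarrow> free_y"
    have eq: "Poly_Mapping.single (Word (l # ls)) a = ?g * Poly_Mapping.single (Word ls) a"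
      by (cases l) (simp_all add: free_x_def free_y_def mult_single plus_word_def)
    have "\<exists>c'. ?g * pbw_sum c - pbw_sum c' \<in> weyl_ideal q"
      using pbw_spanning_x[of c] pbw_spanning_y[of c q] by (cases l) (auto, metis diff_self weyl_ideal_0)
    then obtain c' where c': "?g * pbw_sum c - pbw_sum c' \<in> weyl_ideal q" by blast
    have "?g * (Poly_Mapping.single (Word ls) a - pbw_sum c) + (?g * pbw_sum c - pbw_sum c') \<in> weyl_ideal q"
      by (intro weyl_ideal_add weyl_ideal_lmult c c')
    then have "Poly_Mapping.single (Word (l # ls)) a - pbw_sum c' \<in> weyl_ideal q"
      unfolding eq by (simp add: right_diff_distrib)
    then show ?case ..
  qed
  then show ?case by (metis word.collapse)
next
  case (add f g)
  then obtain c d where "f - pbw_sum c \<in> weyl_ideal q" "g - pbw_sum d \<in> weyl_ideal q" by blast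
  then have "(f - pbw_sum c) + (g - pbw_sum d) \<in> weyl_ideal q" by (rule weyl_ideal_add)
  then have "(f + g) - pbw_sum (c + d) \<in> weyl_ideal q" by (simp add: pbw_sum_add algebra_simps)
  then show ?case ..
qed

section \<open>Linear independence of the ordered monomials\<close>

lemma seq_apply_shift_power: "seq_apply (shift_op ^ n) u j = u (j + int n)"
  by (induction n arbitrary: j) (simp_all add: algebra_simps)

text \<open>The factors are the q-numbers \<open>[j - l]\<close>. At positions
  \<open>0 \<le> j < n\<close> one of them is \<open>[0] = 0\<close>, which
  \<open>pbw_independent\<close> exploits.\<close>

lemma seq_apply_raise_power:
  "seq_apply (raise_op q ^ n) u j = (\<Prod>l<n. (q powi (j - int l) - 1) / (q - 1)) * u (j - int n)"
proof (induction n arbitrary: j)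
  case (Suc n)
  then show ?case
    by (simp add: prod.lessThan_Suc_shift diff_diff_eq[symmetric] mult.assoc del: prod.lessThan_Suc)
qed simp

locale q_generic =
  fixes q :: "'k::field"
  assumes q_nonzero [simp]: "q \<noteq> 0"
    and q_not_root: "n > 0 \<Longrightarrow> q ^ n \<noteq> 1"
begin

lemma q_neq_1 [simp]: "q \<noteq> 1" and q_diff_nonzero [simp]: "q - 1 \<noteq> 0"
  using q_not_root[of 1] by simp_all

lemma q_powi_eq_1_iff [simp]: "q powi i = 1 \<longleftrightarrow> i = 0"
proof
  assume h: "q powi i = 1"
  show "i = 0"
  proof (rule ccontr)
    assume "i \<noteq> 0"
    then have "q ^ nat \<bar>i\<bar> = 1"
      using h by (auto simp: power_int_def abs_if power_inverse split: if_splits)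
    then show False using q_not_root[of "nat \<bar>i\<bar>"] \<open>i \<noteq> 0\<close> by simp
  qed
qed simp

lemma q_powi_eq_iff [simp]: "q powi i = q powi j \<longleftrightarrow> i = j"
proof
  assume "q powi i = q powi j"
  then have "q powi (i - j) = 1" by (simp add: power_int_diff)
  then show "i = j" by simp
qed simp

text \<open>At position j this is the recursion \<open>[j + 1] = q [j] + 1\<close>.\<close>

lemma shift_raise: "shift_op * raise_op q = scalar_op q * raise_op q * shift_op + 1"
proof (rule seq_op_eqI)
  fix u j
  have "(q powi (j + 1) - 1) / (q - 1) = q * ((q powi j - 1) / (q - 1)) + 1"
    by (simp add: field_simps power_int_add)
  then show "seq_apply (shift_op * raise_op q) u j =
      seq_apply (scalar_op q * raise_op q * shift_op + 1) u j"
    by (simp add: distrib_right)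
qed

text \<open>The kernel of the representation is an ideal containing the defining relation, hence
  contains the ideal generated by it.\<close>

lemma weyl_rep_ideal:
  assumes "f \<in> weyl_ideal q"
  shows "weyl_rep q f = 0"
proof -
  let ?F = "ring_of_type_algebra :: 'k free_algebra ring"
  let ?E = "ring_of_type_algebra :: 'k seq_op ring"
  interpret F: ring ?F by (rule ring_of_ring_1)
  have "ring_hom_ring ?F ?E (weyl_rep q)"
    by (rule ring_hom_ringI[OF ring_of_ring_1 ring_of_ring_1])
      (auto simp: ring_of_type_algebra_def weyl_rep_mult weyl_rep_add)
  then have "ideal (a_kernel ?F ?E (weyl_rep q)) ?F"
    by (rule ring_hom_ring.kernel_is_ideal)
  moreover have "{free_y * free_x - (free_scalar q * free_x * free_y + 1)} \<subseteq> a_kernel ?F ?E (weyl_rep q)"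
    by (simp add: a_kernel_def' ring_of_type_algebra_def weyl_rep_diff weyl_rep_add weyl_rep_mult
        shift_raise)
  ultimately have "weyl_ideal q \<subseteq> a_kernel ?F ?E (weyl_rep q)"
    unfolding weyl_ideal_def by (rule F.genideal_minimal)
  then show ?thesis using assms by (auto simp: a_kernel_def' ring_of_type_algebra_def)
qed

lemma weyl_rep_power: "weyl_rep q (f ^ n) = weyl_rep q f ^ n"
  by (induction n) (simp_all add: weyl_rep_mult)

lemma weyl_rep_pbw_sum:
  "weyl_rep q (pbw_sum c) = (\<Sum>(i, j)\<in>Poly_Mapping.keys c.
     scalar_op (Poly_Mapping.lookup c (i, j)) * raise_op q ^ i * shift_op ^ j)"
proof -
  have "weyl_rep q (sum g K) = (\<Sum>k\<in>K. weyl_rep q (g k))" for g and K :: "(nat \<times> nat) set"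
    by (induction K rule: infinite_finite_induct) (simp_all add: weyl_rep_add)
  then show ?thesis
    by (simp add: pbw_sum_def lin_ext_def weyl_rep_mult weyl_rep_power case_prod_beta)
qed

text \<open>
  The lowest power of \<open>x\<close> occurring in \<open>c\<close>, say \<open>x ^ i\<close>, is detected by evaluating at position \<open>i\<close>:
  there all higher powers of \<open>x\<close> vanish because \<open>[0] = 0\<close>.
\<close>

lemma pbw_independent:
  assumes "weyl_rep q (pbw_sum c) = 0"
  shows "c = 0"
proof (rule ccontr)
  assume "c \<noteq> 0"
  let ?K = "Poly_Mapping.keys c"
  have ne: "?K \<noteq> {}" using \<open>c \<noteq> 0\<close> by simp
  define i where "i = Min (fst ` ?K)"
  have "i \<in> fst ` ?K" unfolding i_def by (rule Min_in) (use ne in auto)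
  then obtain j where ij: "(i, j) \<in> ?K" by force
  have least: "i \<le> i'" if "(i', j') \<in> ?K" for i' j'
    unfolding i_def by (rule Min_le) (use that in force)+
  \<comment> \<open>Among the monomials containing exactly \<open>x ^ i\<close>, the unit sequence
    at j selects the one with \<open>y ^ j\<close>.\<close>
  define u :: "int \<Rightarrow> 'k" where "u = (\<lambda>n. if n = int j then 1 else 0)"
  define P where "P = (\<lambda>n. \<Prod>l<n. (q powi (int i - int l) - 1) / (q - 1))"
  have "0 = seq_apply (weyl_rep q (pbw_sum c)) u (int i)"
    by (simp add: assms)
  also have "\<dots> = (\<Sum>k\<in>?K. Poly_Mapping.lookup c k * (P (fst k) * u (int i - int (fst k) + int (snd k))))"
    by (simp add: weyl_rep_pbw_sum seq_apply_sum case_prod_beta seq_apply_shift_power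
        seq_apply_raise_power P_def mult.assoc)
  also have "\<dots> = (\<Sum>k\<in>{(i, j)}. Poly_Mapping.lookup c k * (P (fst k) * u (int i - int (fst k) + int (snd k))))"
  proof (rule sum.mono_neutral_right)
    show "\<forall>k\<in>?K - {(i, j)}. Poly_Mapping.lookup c k * (P (fst k) * u (int i - int (fst k) + int (snd k))) = 0"
    proof
      fix k assume k: "k \<in> ?K - {(i, j)}"
      obtain i' j' where k': "k = (i', j')" by force
      show "Poly_Mapping.lookup c k * (P (fst k) * u (int i - int (fst k) + int (snd k))) = 0"
      proof (cases "i' = i")
        case True
        then show ?thesis using k k' by (auto simp: u_def)
      next
        case False
        then have "i < i'" using least[of i' j'] k k' by auto
        \<comment> \<open>The factor with \<open>l = i\<close> is \<open>[0]\<close>.\<close>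
        then have "P i' = 0" unfolding P_def by (intro prod_zero) (auto intro!: bexI[of _ i])
        then show ?thesis by (simp add: k')
      qed
    qed
  qed (use ij in auto)
  also have "\<dots> = Poly_Mapping.lookup c (i, j) * P i"
    by (simp add: u_def)
  finally have "P i = 0" using ij by (simp add: in_keys_iff)
  then show False unfolding P_def by (auto simp: prod_zero_iff)
qed

text \<open>Faithfulness: modulo the ideal, f is a combination of ordered monomials, and these act
  linearly independently.\<close>

lemma weyl_rep_eq_0_iff: "weyl_rep q f = 0 \<longleftrightarrow> f \<in> weyl_ideal q"
proof
  assume h: "weyl_rep q f = 0"
  obtain c where c: "f - pbw_sum c \<in> weyl_ideal q" using pbw_spanning by blast
  then have "weyl_rep q (pbw_sum c) = 0" using weyl_rep_ideal[OF c] h by (simp add: weyl_rep_diff)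
  then show "f \<in> weyl_ideal q" using c pbw_independent by fastforce
qed (rule weyl_rep_ideal)

lemma weyl_rep_eq_iff: "weyl_rep q f = weyl_rep q g \<longleftrightarrow> weyl_proj q f = weyl_proj q g"
  using weyl_rep_eq_0_iff[of "f - g"] by (simp add: weyl_proj_eq_iff weyl_rep_diff)

end

section \<open>Commutators, symbols and units\<close>

text \<open>Row j, column n of the infinite matrix of A. Unit sequences do not span all sequences,
  so entries determine an operator only in situations such as \<open>weyl_ops_eqI\<close>.\<close>

definition op_entry :: "'k::field seq_op \<Rightarrow> int \<Rightarrow> int \<Rightarrow> 'k"
  where "op_entry A j n = seq_apply A (\<lambda>m. if m = n then 1 else 0) j"

context q_generic
begin

definition weyl_ops :: "'k seq_op set"
  where "weyl_ops = range (weyl_rep q)"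

lemma weyl_ops_closed [intro, simp]:
  shows "scalar_op c \<in> weyl_ops" "raise_op q \<in> weyl_ops" "shift_op \<in> weyl_ops"
    and "0 \<in> weyl_ops" "1 \<in> weyl_ops"
    and "A \<in> weyl_ops \<Longrightarrow> B \<in> weyl_ops \<Longrightarrow> A + B \<in> weyl_ops"
    and "A \<in> weyl_ops \<Longrightarrow> B \<in> weyl_ops \<Longrightarrow> A - B \<in> weyl_ops"
    and "A \<in> weyl_ops \<Longrightarrow> B \<in> weyl_ops \<Longrightarrow> A * B \<in> weyl_ops"
    and "A \<in> weyl_ops \<Longrightarrow> - A \<in> weyl_ops"
proof -
  show "scalar_op c \<in> weyl_ops" "raise_op q \<in> weyl_ops" "shift_op \<in> weyl_ops"
    "0 \<in> weyl_ops" "1 \<in> weyl_ops"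
    using rangeI[of "weyl_rep q" "free_scalar c"] rangeI[of "weyl_rep q" free_x]
      rangeI[of "weyl_rep q" free_y] rangeI[of "weyl_rep q" 0] rangeI[of "weyl_rep q" 1]
    by (simp_all add: weyl_ops_def)
  show "A \<in> weyl_ops \<Longrightarrow> B \<in> weyl_ops \<Longrightarrow> A + B \<in> weyl_ops"
    "A \<in> weyl_ops \<Longrightarrow> B \<in> weyl_ops \<Longrightarrow> A - B \<in> weyl_ops"
    "A \<in> weyl_ops \<Longrightarrow> B \<in> weyl_ops \<Longrightarrow> A * B \<in> weyl_ops"
    "A \<in> weyl_ops \<Longrightarrow> - A \<in> weyl_ops"
    unfolding weyl_ops_def
    by (auto simp: weyl_rep_add[symmetric] weyl_rep_diff[symmetric] weyl_rep_mult[symmetric]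
        weyl_rep_minus[symmetric])
qed

lemma weyl_ops_induct [consumes 1, case_names scalar raise shift add]:
  assumes "A \<in> weyl_ops"
    and scalar: "\<And>c. P (scalar_op c)"
    and raise: "\<And>A. A \<in> weyl_ops \<Longrightarrow> P A \<Longrightarrow> P (raise_op q * A)"
    and shift: "\<And>A. A \<in> weyl_ops \<Longrightarrow> P A \<Longrightarrow> P (shift_op * A)"
    and add: "\<And>A B. A \<in> weyl_ops \<Longrightarrow> B \<in> weyl_ops \<Longrightarrow> P A \<Longrightarrow> P B \<Longrightarrow> P (A + B)"
  shows "P A"
proof -
  have "P (weyl_rep q f)" for f
  proof (induction f rule: poly_mapping_additive_induct)
    case zero
    show ?case using scalar[of 0] by simp
  next
    case (single w c)
    \<comment> \<open>The coefficient stands at the right end, so that the word grows from the base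
      case \<open>scalar_op c\<close> by left multiplications. Membership is carried along because
      the cases \<open>raise\<close> and \<open>shift\<close> ask for it.\<close>
    have "P (word_op q (Word ls) * scalar_op c) \<and> word_op q (Word ls) * scalar_op c \<in> weyl_ops" for ls
    proof (induction ls)
      case Nil
      show ?case using scalar[of c] by (simp add: word_op_def)
    next
      case (Cons l ls)
      have "word_op q (Word (l # ls)) * scalar_op c = letter_op q l * (word_op q (Word ls) * scalar_op c)"
        by (simp add: word_op_def mult.assoc)
      then show ?case using Cons raise shift by (cases l) auto
    qed
    from this[of "letters w"] show ?case
      by (simp add: weyl_rep_single scalar_op_commute)
  next
    case (add f g)
    then show ?case by (simp add: weyl_rep_add assms weyl_ops_def)
  qed
  then show ?thesis using assms(1) by (auto simp: weyl_ops_def)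
qed

text \<open>At position j this is \<open>[j + 1] - [j] = q powi j\<close>. Writing h as a commutator
  gives control over its image under automorphisms.\<close>

lemma diag_commutator: "diag_op q = shift_op * raise_op q - raise_op q * shift_op"
proof (rule seq_op_eqI)
  fix u j
  have "(q powi (j + 1) - 1) / (q - 1) - (q powi j - 1) / (q - 1) = (q - 1) * q powi j / (q - 1)"
    unfolding diff_divide_distrib[symmetric] by (simp add: power_int_add algebra_simps)
  then have eq: "(q powi (j + 1) - 1) / (q - 1) - (q powi j - 1) / (q - 1) = q powi j"
    by simp
  have "seq_apply (shift_op * raise_op q - raise_op q * shift_op) u j
      = ((q powi (j + 1) - 1) / (q - 1) - (q powi j - 1) / (q - 1)) * u j"
    by (simp add: left_diff_distrib)
  then show "seq_apply (diag_op q) u j = seq_apply (shift_op * raise_op q - raise_op q * shift_op) u j"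
    by (simp only: eq seq_apply_simps)
qed

lemma diag_eq: "diag_op q = 1 + scalar_op (q - 1) * (raise_op q * shift_op)"
proof (rule seq_op_eqI)
  fix u j
  have "seq_apply (1 + scalar_op (q - 1) * (raise_op q * shift_op)) u j = u j + (q powi j - 1) * u j"
    by simp
  also have "\<dots> = q powi j * u j"
    by (simp add: left_diff_distrib)
  finally show "seq_apply (diag_op q) u j = seq_apply (1 + scalar_op (q - 1) * (raise_op q * shift_op)) u j"
    by simp
qed

lemma diag_in_weyl_ops [simp]: "diag_op q \<in> weyl_ops"
  by (simp add: diag_commutator)

text \<open>With \<open>shift_diag\<close>: h is normal, and conjugation by h has x and y as
  eigenvectors, with eigenvalues that later serve as degrees -1 and 1.\<close>

lemma raise_diag: "raise_op q * diag_op q = diag_op q * (scalar_op (inverse q) * raise_op q)"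
  by (rule seq_op_eqI) (simp add: power_int_diff field_simps)

lemma shift_diag: "shift_op * diag_op q = diag_op q * (scalar_op q * shift_op)"
  by (rule seq_op_eqI) (simp add: power_int_add)

lemma diag_cancel: "diag_op q * A = diag_op q * B \<longleftrightarrow> A = B"
proof
  assume h: "diag_op q * A = diag_op q * B"
  show "A = B"
  proof (rule seq_op_eqI)
    fix u j
    have "seq_apply (diag_op q * A) u j = seq_apply (diag_op q * B) u j"
      using h by simp
    then show "seq_apply A u j = seq_apply B u j" by simp
  qed
qed simp

section \<open>The two-sided ideal generated by h, and commutators\<close>

definition weyl_diag_ideal :: "'k seq_op set"
  where "weyl_diag_ideal = (\<lambda>C. diag_op q * C) ` weyl_ops"

lemma weyl_diag_ideal_add:
  "A \<in> weyl_diag_ideal \<Longrightarrow> B \<in> weyl_diag_ideal \<Longrightarrow> A + B \<in> weyl_diag_ideal"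
  unfolding weyl_diag_ideal_def by (auto simp: distrib_left[symmetric])

lemma weyl_diag_ideal_rmult:
  "A \<in> weyl_diag_ideal \<Longrightarrow> B \<in> weyl_ops \<Longrightarrow> A * B \<in> weyl_diag_ideal"
  unfolding weyl_diag_ideal_def by (auto simp: mult.assoc)

text \<open>Normality of h extends from the generators to all A: there is A' in
  \<open>weyl_ops\<close> with \<open>A * diag_op q = diag_op q * A'\<close>, so the right ideal h R
  is also a left ideal.\<close>

lemma weyl_diag_ideal_lmult:
  assumes "A \<in> weyl_ops" "B \<in> weyl_diag_ideal"
  shows "A * B \<in> weyl_diag_ideal"
proof -
  have "\<exists>A'\<in>weyl_ops. A * diag_op q = diag_op q * A'"
    using assms(1)
  proof (induction rule: weyl_ops_induct)
    case (scalar c)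
    then show ?case by (intro bexI[of _ "scalar_op c"]) (simp_all add: scalar_op_commute)
  next
    case (raise A)
    then obtain A' where A': "A' \<in> weyl_ops" "A * diag_op q = diag_op q * A'" by blast
    then have "raise_op q * A * diag_op q = diag_op q * (scalar_op (inverse q) * raise_op q * A')"
      by (metis mult.assoc raise_diag)
    then show ?case using A' by auto
  next
    case (shift A)
    then obtain A' where A': "A' \<in> weyl_ops" "A * diag_op q = diag_op q * A'" by blast
    then have "shift_op * A * diag_op q = diag_op q * (scalar_op q * shift_op * A')"
      by (metis mult.assoc shift_diag)
    then show ?case using A' by auto
  next
    case (add A B)
    then obtain A' B' where "A' \<in> weyl_ops" "A * diag_op q = diag_op q * A'"
      "B' \<in> weyl_ops" "B * diag_op q = diag_op q * B'" by blast
    then show ?case by (intro bexI[of _ "A' + B'"]) (simp_all add: distrib_left distrib_right)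
  qed
  then obtain A' where A': "A' \<in> weyl_ops" "A * diag_op q = diag_op q * A'" by blast
  obtain C where "C \<in> weyl_ops" "B = diag_op q * C" using assms(2) by (auto simp: weyl_diag_ideal_def)
  then have "A * B = diag_op q * (A' * C)" by (metis A'(2) mult.assoc)
  then show ?thesis using A' \<open>C \<in> weyl_ops\<close> by (auto simp: weyl_diag_ideal_def)
qed

text \<open>In other words, R modulo h is commutative. The commutator with a fixed B is a
  derivation, so generators suffice. \<open>gen\<close> is applied first to B against x and y, then
  to A against B.\<close>

lemma commutator_in_diag_ideal:
  assumes "A \<in> weyl_ops" "B \<in> weyl_ops"
  shows "A * B - B * A \<in> weyl_diag_ideal"
proof -
  have diag: "shift_op * raise_op q - raise_op q * shift_op \<in> weyl_diag_ideal"
    unfolding diag_commutator[symmetric] weyl_diag_ideal_def by (intro image_eqI[of _ _ 1]) auto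
  have minus: "- A \<in> weyl_diag_ideal" if "A \<in> weyl_diag_ideal" for A
    using weyl_diag_ideal_rmult[OF that, of "- 1"] by simp
  have zero: "0 \<in> weyl_diag_ideal"
    unfolding weyl_diag_ideal_def by (intro image_eqI[of _ _ 0]) auto
  have swap: "B * A - A * B \<in> weyl_diag_ideal" if "A * B - B * A \<in> weyl_diag_ideal" for A B
    using minus[OF that] by simp
  have step: "(C * A) * B - B * (C * A) \<in> weyl_diag_ideal"
    if "A \<in> weyl_ops" "C \<in> weyl_ops" "A * B - B * A \<in> weyl_diag_ideal" "C * B - B * C \<in> weyl_diag_ideal"
    for A B C
  proof -
    have "(C * A) * B - B * (C * A) = C * (A * B - B * A) + (C * B - B * C) * A"
      by (simp add: algebra_simps)
    then show ?thesis
      using weyl_diag_ideal_add[OF weyl_diag_ideal_lmult[OF that(2,3)] weyl_diag_ideal_rmult[OF that(4,1)]]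
      by (simp only:)
  qed
  have additive: "(A + C) * B - B * (A + C) \<in> weyl_diag_ideal"
    if "A * B - B * A \<in> weyl_diag_ideal" "C * B - B * C \<in> weyl_diag_ideal" for A B C
  proof -
    have "(A + C) * B - B * (A + C) = (A * B - B * A) + (C * B - B * C)"
      by (simp add: algebra_simps)
    then show ?thesis using weyl_diag_ideal_add[OF that] by (simp only:)
  qed
  have gen: "A * B - B * A \<in> weyl_diag_ideal"
    if "A \<in> weyl_ops" "raise_op q * B - B * raise_op q \<in> weyl_diag_ideal"
      "shift_op * B - B * shift_op \<in> weyl_diag_ideal" for A B
    using that(1)
  proof (induction rule: weyl_ops_induct)
    case (scalar c)
    show ?case using zero by (simp only: scalar_op_commute[of c B] diff_self)
  next
    case (raise A)
    then show ?case by (intro step[OF _ _ _ that(2)] weyl_ops_closed)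
  next
    case (shift A)
    then show ?case by (intro step[OF _ _ _ that(3)] weyl_ops_closed)
  next
    case (add A B)
    then show ?case by (intro additive)
  qed
  have "B * raise_op q - raise_op q * B \<in> weyl_diag_ideal" "B * shift_op - shift_op * B \<in> weyl_diag_ideal"
    using gen[OF assms(2), of "raise_op q"] gen[OF assms(2), of shift_op] diag zero swap[OF diag]
    by simp_all
  then show ?thesis
    by (rule gen[OF assms(1) swap swap])
qed

text \<open>
  This invariance, due to \<open>[0] = 0\<close>, separates \<open>R\<close> from the larger algebra of all operators with a
  symbol, in which the shift is invertible.
\<close>

lemma weyl_ops_preserve:
  assumes "A \<in> weyl_ops" "\<And>j. j \<ge> 0 \<Longrightarrow> u j = 0" "j \<ge> 0"
  shows "seq_apply A u j = 0"
  using assms(1,3)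
proof (induction arbitrary: j rule: weyl_ops_induct)
  case (raise A)
  then show ?case by (cases "j = 0") auto
qed (use assms(2) in auto)

lemma op_entry_preserve: "A \<in> weyl_ops \<Longrightarrow> n < 0 \<Longrightarrow> j \<ge> 0 \<Longrightarrow> op_entry A j n = 0"
  unfolding op_entry_def by (rule weyl_ops_preserve) auto

section \<open>Symbols of operators\<close>

lemma finite_powi_roots:
  assumes "P \<noteq> 0"
  shows "finite {j :: int. poly P (q powi j) = 0}"
proof (rule finite_subset)
  show "{j :: int. poly P (q powi j) = 0} \<subseteq> (\<lambda>j. q powi j) -` {x. poly P x = 0}" by auto
  show "finite ((\<lambda>j. q powi j) -` {x. poly P x = 0})"
    by (rule finite_vimageI) (auto simp: poly_roots_finite assms inj_def)
qed

text \<open>The points \<open>q powi j\<close> are pairwise distinct, hence infinitely many, and the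
  difference of two distinct polynomials has finitely many roots.\<close>

lemma poly_eq_powiI:
  assumes "\<And>j :: int. poly P (q powi j) = poly Q (q powi j)"
  shows "P = Q"
proof (rule ccontr)
  assume "P \<noteq> Q"
  then have "finite {j :: int. poly (P - Q) (q powi j) = 0}" by (intro finite_powi_roots) simp
  moreover have "{j :: int. poly (P - Q) (q powi j) = 0} = UNIV" using assms by auto
  ultimately show False by (simp add: infinite_UNIV_int)
qed

definition is_symbol :: "'k seq_op \<Rightarrow> (int \<Rightarrow> 'k poly) \<Rightarrow> bool"
  where "is_symbol A F \<longleftrightarrow> finite {k. F k \<noteq> 0} \<and>
    (\<forall>u j. seq_apply A u j = (\<Sum>k | F k \<noteq> 0. poly (F k) (q powi j) * u (j + k)))"

lemma is_symbol_finite: "is_symbol A F \<Longrightarrow> finite {k. F k \<noteq> 0}"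
  by (simp add: is_symbol_def)

lemma is_symbol_apply:
  assumes "is_symbol A F" "finite K" "{k. F k \<noteq> 0} \<subseteq> K"
  shows "seq_apply A u j = (\<Sum>k\<in>K. poly (F k) (q powi j) * u (j + k))"
  using assms unfolding is_symbol_def by (auto intro!: sum.mono_neutral_left)

lemma is_symbolI:
  assumes "finite K" "{k. F k \<noteq> 0} \<subseteq> K"
    and "\<And>u j. seq_apply A u j = (\<Sum>k\<in>K. poly (F k) (q powi j) * u (j + k))"
  shows "is_symbol A F"
  unfolding is_symbol_def using assms
  by (auto intro: finite_subset intro!: sum.mono_neutral_right)

lemma is_symbol_entry:
  assumes "is_symbol A F"
  shows "op_entry A j n = poly (F (n - j)) (q powi j)"
proof -
  \<comment> \<open>The index \<open>n - j\<close> is inserted because \<open>F (n - j)\<close> may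
    be zero, in which case it is missing from the support.\<close>
  have "op_entry A j n = (\<Sum>k\<in>insert (n - j) {k. F k \<noteq> 0}. poly (F k) (q powi j) * (if j + k = n then 1 else 0))"
    unfolding op_entry_def using assms is_symbol_finite[OF assms] by (intro is_symbol_apply) auto
  also have "\<dots> = (\<Sum>k\<in>{n - j}. poly (F k) (q powi j) * (if j + k = n then 1 else 0))"
    using is_symbol_finite[OF assms] by (intro sum.mono_neutral_right) auto
  finally show ?thesis by simp
qed

text \<open>Letting x or y act after A moves the position, which substitutes t/q or q t for the
  variable t of the symbol. In addition x contributes (t - 1)/(q - 1), which is \<open>[j]\<close>
  at \<open>t = q powi j\<close>.\<close>

lemma symbol_exists:
  assumes "A \<in> weyl_ops"
  shows "\<exists>F. is_symbol A F"
  using assms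
proof (induction rule: weyl_ops_induct)
  case (scalar c)
  show ?case
    by (rule exI[of _ "\<lambda>k. if k = 0 then [:c:] else 0"], rule is_symbolI[of "{0}"]) auto
next
  case (raise A)
  then obtain F where F: "is_symbol A F" by blast
  let ?G = "\<lambda>k. Polynomial.smult (1 / (q - 1)) ([:- 1, 1:] * pcompose (F (k + 1)) [:0, inverse q:])"
  let ?K = "{k. F k \<noteq> 0}"
  have "is_symbol (raise_op q * A) ?G"
  proof (rule is_symbolI[of "(\<lambda>k. k - 1) ` ?K"])
    show "finite ((\<lambda>k. k - 1) ` ?K)" using is_symbol_finite[OF F] by simp
    show "{k. ?G k \<noteq> 0} \<subseteq> (\<lambda>k. k - 1) ` ?K"
    proof
      fix k assume "k \<in> {k. ?G k \<noteq> 0}"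
      then have "k + 1 \<in> ?K" by auto
      then show "k \<in> (\<lambda>k. k - 1) ` ?K" by (intro image_eqI[of _ _ "k + 1"]) auto
    qed
    fix u and j :: int
    have "seq_apply (raise_op q * A) u j =
        (q powi j - 1) / (q - 1) * (\<Sum>k\<in>?K. poly (F k) (q powi (j - 1)) * u (j - 1 + k))"
      using is_symbol_apply[OF F is_symbol_finite[OF F] order.refl] by simp
    also have "\<dots> = (\<Sum>k\<in>?K. poly (?G (k - 1)) (q powi j) * u (j + (k - 1)))"
      by (simp add: sum_distrib_left poly_pcompose power_int_diff field_simps)
    also have "\<dots> = (\<Sum>k\<in>(\<lambda>k. k - 1) ` ?K. poly (?G k) (q powi j) * u (j + k))"
      by (subst sum.reindex) (auto simp: inj_on_def)
    finally show "seq_apply (raise_op q * A) u j =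
      (\<Sum>k\<in>(\<lambda>k. k - 1) ` ?K. poly (?G k) (q powi j) * u (j + k))" .
  qed
  then show ?case by (rule exI[of _ ?G])
next
  case (shift A)
  then obtain F where F: "is_symbol A F" by blast
  let ?G = "\<lambda>k. pcompose (F (k - 1)) [:0, q:]"
  let ?K = "{k. F k \<noteq> 0}"
  have "is_symbol (shift_op * A) ?G"
  proof (rule is_symbolI[of "(\<lambda>k. k + 1) ` ?K"])
    show "finite ((\<lambda>k. k + 1) ` ?K)" using is_symbol_finite[OF F] by simp
    show "{k. ?G k \<noteq> 0} \<subseteq> (\<lambda>k. k + 1) ` ?K"
    proof
      fix k assume "k \<in> {k. ?G k \<noteq> 0}"
      then have "k - 1 \<in> ?K" by auto
      then show "k \<in> (\<lambda>k. k + 1) ` ?K" by (intro image_eqI[of _ _ "k - 1"]) auto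
    qed
    fix u and j :: int
    have "seq_apply (shift_op * A) u j =
        (\<Sum>k\<in>?K. poly (F k) (q powi (j + 1)) * u (j + 1 + k))"
      using is_symbol_apply[OF F is_symbol_finite[OF F] order.refl] by simp
    also have "\<dots> = (\<Sum>k\<in>?K. poly (?G (k + 1)) (q powi j) * u (j + (k + 1)))"
      by (simp add: poly_pcompose power_int_add algebra_simps)
    also have "\<dots> = (\<Sum>k\<in>(\<lambda>k. k + 1) ` ?K. poly (?G k) (q powi j) * u (j + k))"
      by (subst sum.reindex) (auto simp: inj_on_def)
    finally show "seq_apply (shift_op * A) u j =
      (\<Sum>k\<in>(\<lambda>k. k + 1) ` ?K. poly (?G k) (q powi j) * u (j + k))" .
  qed
  then show ?case by (rule exI[of _ ?G])
next
  case (add A B)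
  then obtain F G where F: "is_symbol A F" and G: "is_symbol B G" by blast
  let ?K = "{k. F k \<noteq> 0} \<union> {k. G k \<noteq> 0}"
  have fin: "finite ?K" by (rule finite_UnI[OF is_symbol_finite[OF F] is_symbol_finite[OF G]])
  have "is_symbol (A + B) (\<lambda>k. F k + G k)"
    by (rule is_symbolI[of ?K])
      (auto simp: is_symbol_finite[OF F] is_symbol_finite[OF G] is_symbol_apply[OF F fin]
        is_symbol_apply[OF G fin] sum.distrib distrib_right)
  then show ?case by (rule exI[of _ "\<lambda>k. F k + G k"])
qed

text \<open>Entries give the values of the symbol at all \<open>q powi j\<close>, hence the symbol
  itself, and this determines the operator on all sequences, including those of infinite
  support.\<close>

lemma weyl_ops_eqI:
  assumes "A \<in> weyl_ops" "B \<in> weyl_ops" "\<And>j n. op_entry A j n = op_entry B j n"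
  shows "A = B"
proof -
  obtain F G where F: "is_symbol A F" and G: "is_symbol B G"
    using symbol_exists[OF assms(1)] symbol_exists[OF assms(2)] by blast
  have "F k = G k" for k
  proof (rule poly_eq_powiI)
    fix j
    show "poly (F k) (q powi j) = poly (G k) (q powi j)"
      using assms(3)[of j "j + k"] by (simp add: is_symbol_entry[OF F] is_symbol_entry[OF G])
  qed
  then have "F = G" by (rule ext)
  have "seq_apply A u j = seq_apply B u j" for u j
    using F G unfolding is_symbol_def \<open>F = G\<close> by simp
  then show ?thesis by (rule seq_op_eqI)
qed

lemma op_entry_simps:
  "op_entry 1 j n = (if j = n then 1 else 0)"
  "op_entry (scalar_op c * A) j n = c * op_entry A j n"
  "op_entry (diag_op c * A) j n = c powi j * op_entry A j n"
  "op_entry (A * diag_op c) j n = c powi n * op_entry A j n"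
  "op_entry (A + B) j n = op_entry A j n + op_entry B j n"
  "op_entry (raise_op q) j n = (if n = j - 1 then (q powi j - 1) / (q - 1) else 0)"
  "op_entry shift_op j n = (if n = j + 1 then 1 else 0)"
proof -
  have "seq_apply (diag_op c) (\<lambda>m. if m = n then 1 else 0) = (\<lambda>m. c powi n * (if m = n then 1 else 0))"
    by auto
  then show "op_entry (A * diag_op c) j n = c powi n * op_entry A j n"
    by (simp add: op_entry_def seq_apply_scale)
qed (auto simp: op_entry_def)

lemma op_entry_mult:
  assumes "is_symbol A F"
  shows "op_entry (A * B) j n = (\<Sum>k | F k \<noteq> 0. poly (F k) (q powi j) * op_entry B (j + k) n)"
  using assms unfolding is_symbol_def op_entry_def by simp

text \<open>In the convolution of the symbols only the splitting of s as L plus s - L survives. This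
  applies to extreme degrees and to homogeneous factors.\<close>

lemma op_entry_mult_extreme:
  assumes "is_symbol A F" "is_symbol B G" "\<And>k. F k \<noteq> 0 \<Longrightarrow> G (s - k) \<noteq> 0 \<Longrightarrow> k = L"
  shows "op_entry (A * B) j (j + s) = poly (F L) (q powi j) * poly (G (s - L)) (q powi (j + L))"
proof -
  let ?t = "\<lambda>k. poly (F k) (q powi j) * poly (G (s - k)) (q powi (j + k))"
  have "op_entry (A * B) j (j + s) = (\<Sum>k | F k \<noteq> 0. ?t k)"
    by (simp add: op_entry_mult[OF assms(1)] is_symbol_entry[OF assms(2)])
  also have "\<dots> = (\<Sum>k\<in>insert L {k. F k \<noteq> 0}. ?t k)"
    using is_symbol_finite[OF assms(1)] by (intro sum.mono_neutral_left) auto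
  also have "\<dots> = (\<Sum>k\<in>{L}. ?t k)"
  proof (rule sum.mono_neutral_right)
    show "\<forall>k\<in>insert L {k. F k \<noteq> 0} - {L}. ?t k = 0"
    proof
      fix k assume "k \<in> insert L {k. F k \<noteq> 0} - {L}"
      then have "G (s - k) = 0" using assms(3)[of k] by auto
      then show "?t k = 0" by simp
    qed
  qed (use is_symbol_finite[OF assms(1)] in auto)
  finally show ?thesis by simp
qed

text \<open>Each factor vanishes for finitely many j only.\<close>

lemma symbol_product_nonzero:
  assumes "P \<noteq> 0" "Q \<noteq> 0"
  shows "\<exists>j. poly P (q powi j) * poly Q (q powi (j + L)) \<noteq> 0"
proof (rule ccontr)
  assume "\<not> ?thesis"
  then have "UNIV \<subseteq> {j :: int. poly P (q powi j) = 0} \<union> (\<lambda>j. j + L) -` {j :: int. poly Q (q powi j) = 0}"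
    by auto
  moreover have "finite ({j :: int. poly P (q powi j) = 0} \<union> (\<lambda>j. j + L) -` {j :: int. poly Q (q powi j) = 0})"
    using assms by (intro finite_UnI finite_vimageI finite_powi_roots) (auto simp: inj_def)
  ultimately show False using infinite_UNIV_int finite_subset by blast
qed

text \<open>
  The highest and the lowest symbols of mutually inverse operators multiply to the symbols of
  \<open>1\<close>, so both operators are homogeneous; \<open>weyl_ops_preserve\<close> then forces degree \<open>0\<close>.
\<close>

lemma weyl_ops_unit:
  assumes U: "U \<in> weyl_ops" and W: "W \<in> weyl_ops" and UW: "U * W = 1"
  shows "\<exists>c. c \<noteq> 0 \<and> U = scalar_op c"
proof -
  obtain F G where F: "is_symbol U F" and G: "is_symbol W G"
    using symbol_exists[OF U] symbol_exists[OF W] by blast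
  \<comment> \<open>A nonzero entry of the product shows that both symbols have nonempty support, so
    that the maxima and minima below make sense.\<close>
  have "op_entry (U * W) 0 0 \<noteq> 0" by (simp add: UW op_entry_simps)
  then have "(\<Sum>k | F k \<noteq> 0. poly (F k) (q powi 0) * poly (G (- k)) (q powi k)) \<noteq> 0"
    by (simp add: op_entry_mult[OF F] is_symbol_entry[OF G])
  then obtain k where "F k \<noteq> 0" "poly (G (- k)) (q powi k) \<noteq> 0"
    by (rule sum.not_neutral_contains_not_neutral) auto
  then have ex: "\<exists>k. F k \<noteq> 0" "\<exists>k. G k \<noteq> 0"
    by (metis poly_0)+
  define L l where "L = Max {k. F k \<noteq> 0}" and "l = Min {k. F k \<noteq> 0}"
  define L' l' where "L' = Max {k. G k \<noteq> 0}" and "l' = Min {k. G k \<noteq> 0}"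
  note fin = is_symbol_finite[OF F] is_symbol_finite[OF G]
  have L: "F L \<noteq> 0" "F l \<noteq> 0" "G L' \<noteq> 0" "G l' \<noteq> 0"
    using Max_in[OF fin(1)] Min_in[OF fin(1)] Max_in[OF fin(2)] Min_in[OF fin(2)] ex
    unfolding L_def l_def L'_def l'_def by auto
  have bounds: "l \<le> k \<and> k \<le> L" if "F k \<noteq> 0" for k
    unfolding L_def l_def using that by (intro conjI Min_le Max_ge fin) simp_all
  have bounds': "l' \<le> k \<and> k \<le> L'" if "G k \<noteq> 0" for k
    unfolding L'_def l'_def using that by (intro conjI Min_le Max_ge fin) simp_all
  have one: "op_entry (U * W) j (j + s) = (if s = 0 then 1 else 0)" for j s
    by (simp add: UW op_entry_simps)
  have "k = L" if "F k \<noteq> 0" "G (L + L' - k) \<noteq> 0" for k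
    using bounds[OF that(1)] bounds'[OF that(2)] by linarith
  then have top: "op_entry (U * W) j (j + (L + L')) = poly (F L) (q powi j) * poly (G L') (q powi (j + L))" for j
    using op_entry_mult_extreme[OF F G, of "L + L'" L] by simp
  have "k = l" if "F k \<noteq> 0" "G (l + l' - k) \<noteq> 0" for k
    using bounds[OF that(1)] bounds'[OF that(2)] by linarith
  then have bot: "op_entry (U * W) j (j + (l + l')) = poly (F l) (q powi j) * poly (G l') (q powi (j + l))" for j
    using op_entry_mult_extreme[OF F G, of "l + l'" l] by simp
  obtain j where "poly (F L) (q powi j) * poly (G L') (q powi (j + L)) \<noteq> 0"
    using symbol_product_nonzero[OF L(1,3), of L] by blast
  then have "L + L' = 0"
    using top[of j] one[of j "L + L'"] by metis
  moreover obtain j where "poly (F l) (q powi j) * poly (G l') (q powi (j + l)) \<noteq> 0"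
    using symbol_product_nonzero[OF L(2,4), of l] by blast
  then have "l + l' = 0"
    using bot[of j] one[of j "l + l'"] by metis
  \<comment> \<open>The degree ranges of the two symbols add up to \<open>{0}\<close>, so each
    consists of one degree.\<close>
  ultimately have eqs: "l = L" "l' = - L" "L' = - L"
    using bounds[OF L(1)] bounds'[OF L(3)] by auto
  have prod: "poly (F L) (q powi j) * poly (G (- L)) (q powi (j + L)) = 1" for j
    using top[of j] one[of j 0] eqs by simp
  \<comment> \<open>The symbol of U in degree L is a unit among polynomials, hence a nonzero
    constant. The substitution accounts for W acting at position \<open>j + L\<close>.\<close>
  have "F L * pcompose (G (- L)) [:0, q powi L:] = 1"
  proof (rule poly_eq_powiI)
    fix j
    show "poly (F L * pcompose (G (- L)) [:0, q powi L:]) (q powi j) = poly 1 (q powi j)"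
      using prod[of j] by (simp add: poly_pcompose power_int_add)
  qed
  then have "F L dvd 1" by (metis dvd_triv_left)
  then obtain c where c: "F L = [:c:]"
    by (rule is_unit_polyE)
  then have "c \<noteq> 0"
    using L(1) by auto
  \<comment> \<open>Column -1 is paired with a nonnegative row at offset L in U, or at offset -L in
    W. Such an entry must vanish by \<open>op_entry_preserve\<close>, but it is a nonzero value of
    the symbol.\<close>
  have "L = 0"
  proof (rule ccontr)
    assume "L \<noteq> 0"
    then consider "L < 0" | "L > 0" by linarith
    then show False
    proof cases
      case 1
      then have "op_entry U (- 1 - L) (- 1) = 0" by (intro op_entry_preserve U) auto
      then show False using c \<open>c \<noteq> 0\<close> by (simp add: is_symbol_entry[OF F])
    next
      case 2
      then have "op_entry W (L - 1) (- 1) = 0" by (intro op_entry_preserve W) auto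
      then show False using prod[of "- 1"] by (simp add: is_symbol_entry[OF G])
    qed
  qed
  have "U = scalar_op c"
  proof (rule weyl_ops_eqI[OF U])
    fix j n
    have "F (n - j) = 0" if "n \<noteq> j" using bounds[of "n - j"] eqs \<open>L = 0\<close> that by auto
    then show "op_entry U j n = op_entry (scalar_op c) j n"
      using c \<open>L = 0\<close> op_entry_simps(2)[of c 1 j n]
      by (cases "n = j") (simp_all add: is_symbol_entry[OF F] op_entry_simps(1))
  qed simp
  then show ?thesis using \<open>c \<noteq> 0\<close> by blast
qed


section \<open>Automorphisms\<close>

text \<open>Algebra automorphisms transported to operators; fixing scalars together with
  multiplicativity amounts to linearity.\<close>

definition weyl_ops_aut :: "('k seq_op \<Rightarrow> 'k seq_op) \<Rightarrow> bool"
  where "weyl_ops_aut R \<longleftrightarrow> bij_betw R weyl_ops weyl_ops \<and>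
    (\<forall>A\<in>weyl_ops. \<forall>B\<in>weyl_ops. R (A + B) = R A + R B \<and> R (A * B) = R A * R B) \<and>
    (\<forall>c. R (scalar_op c) = scalar_op c)"

lemma weyl_ops_autD:
  assumes "weyl_ops_aut R"
  shows "A \<in> weyl_ops \<Longrightarrow> R A \<in> weyl_ops"
    and "A \<in> weyl_ops \<Longrightarrow> B \<in> weyl_ops \<Longrightarrow> R (A + B) = R A + R B"
    and "A \<in> weyl_ops \<Longrightarrow> B \<in> weyl_ops \<Longrightarrow> R (A * B) = R A * R B"
    and "R (scalar_op c) = scalar_op c"
    and "R 1 = 1"
    and "A \<in> weyl_ops \<Longrightarrow> B \<in> weyl_ops \<Longrightarrow> R (A - B) = R A - R B"
proof -
  show mem: "A \<in> weyl_ops \<Longrightarrow> R A \<in> weyl_ops" for A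
    using assms unfolding weyl_ops_aut_def by (meson bij_betwE)
  show add: "A \<in> weyl_ops \<Longrightarrow> B \<in> weyl_ops \<Longrightarrow> R (A + B) = R A + R B"
    and "A \<in> weyl_ops \<Longrightarrow> B \<in> weyl_ops \<Longrightarrow> R (A * B) = R A * R B" for A B
    using assms unfolding weyl_ops_aut_def by blast+
  show scalar: "R (scalar_op c) = scalar_op c" for c
    using assms unfolding weyl_ops_aut_def by blast
  show "R 1 = 1" using scalar[of 1] by simp
  show "R (A - B) = R A - R B" if "A \<in> weyl_ops" "B \<in> weyl_ops"
    using add[of "A - B" B] that by (simp add: eq_diff_eq)
qed

lemma weyl_ops_aut_inv:
  assumes "weyl_ops_aut R"
  shows "weyl_ops_aut (inv_into weyl_ops R)"
proof -
  let ?I = "inv_into weyl_ops R"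
  have bij: "bij_betw R weyl_ops weyl_ops" using assms by (simp add: weyl_ops_aut_def)
  have bij': "bij_betw ?I weyl_ops weyl_ops" by (rule bij_betw_inv_into[OF bij])
  have left: "?I (R A) = A" if "A \<in> weyl_ops" for A
    by (rule bij_betw_inv_into_left[OF bij that])
  have right: "R (?I A) = A" if "A \<in> weyl_ops" for A
    by (rule bij_betw_inv_into_right[OF bij that])
  have mem: "?I A \<in> weyl_ops" if "A \<in> weyl_ops" for A
    using bij' that by (meson bij_betwE)
  have "?I (A + B) = ?I A + ?I B" if "A \<in> weyl_ops" "B \<in> weyl_ops" for A B
    using left[of "?I A + ?I B"] that by (simp add: mem right weyl_ops_autD[OF assms])
  moreover have "?I (A * B) = ?I A * ?I B" if "A \<in> weyl_ops" "B \<in> weyl_ops" for A B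
    using left[of "?I A * ?I B"] that by (simp add: mem right weyl_ops_autD[OF assms])
  moreover have "?I (scalar_op c) = scalar_op c" for c
    using left[of "scalar_op c"] by (simp add: weyl_ops_autD[OF assms])
  ultimately show ?thesis using bij' unfolding weyl_ops_aut_def by blast
qed

text \<open>As h is a commutator, so is its image.\<close>

lemma weyl_ops_aut_diag_in_ideal:
  assumes "weyl_ops_aut R"
  obtains U where "U \<in> weyl_ops" "R (diag_op q) = diag_op q * U"
proof -
  have "R (diag_op q) = R shift_op * R (raise_op q) - R (raise_op q) * R shift_op"
    by (simp add: diag_commutator weyl_ops_autD[OF assms])
  also have "\<dots> \<in> weyl_diag_ideal"
    by (intro commutator_in_diag_ideal weyl_ops_autD[OF assms] weyl_ops_closed)
  finally show ?thesis using that by (auto simp: weyl_diag_ideal_def)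
qed

text \<open>Both R and its inverse send h to a multiple of h, say h U and h W. Then h = h U R(W);
  cancelling h, U has a right inverse and is a scalar by \<open>weyl_ops_unit\<close>.\<close>

lemma weyl_ops_aut_diag:
  assumes R: "weyl_ops_aut R"
  obtains c where "c \<noteq> 0" "R (diag_op q) = scalar_op c * diag_op q"
proof -
  let ?I = "inv_into weyl_ops R"
  have I: "weyl_ops_aut ?I" by (rule weyl_ops_aut_inv[OF R])
  have right: "R (?I (diag_op q)) = diag_op q"
    by (rule bij_betw_inv_into_right) (use R in \<open>auto simp: weyl_ops_aut_def\<close>)
  obtain U where U: "U \<in> weyl_ops" "R (diag_op q) = diag_op q * U"
    using weyl_ops_aut_diag_in_ideal[OF R] by blast
  obtain W where W: "W \<in> weyl_ops" "?I (diag_op q) = diag_op q * W"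
    using weyl_ops_aut_diag_in_ideal[OF I] by blast
  have "diag_op q * (U * R W) = R (?I (diag_op q))"
    unfolding W(2) by (simp add: weyl_ops_autD[OF R] W U(2) mult.assoc)
  then have "diag_op q * (U * R W) = diag_op q * 1" by (simp add: right)
  then have "U * R W = 1" by (simp only: diag_cancel)
  then obtain c where "c \<noteq> 0" "U = scalar_op c"
    using weyl_ops_unit[OF U(1) weyl_ops_autD(1)[OF R W(1)]] by blast
  then show ?thesis using that[of c] U(2) by (simp add: scalar_op_commute)
qed

text \<open>Comparing entries multiplies the same number by \<open>q powi n\<close> and by
  \<open>q powi (j + i)\<close>: eigenvectors of conjugation by h live on a single diagonal of the
  matrix.\<close>

lemma op_entry_homogeneous:
  assumes "A * diag_op q = scalar_op (q powi i) * diag_op q * A" "n \<noteq> j + i"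
  shows "op_entry A j n = 0"
proof -
  have "q powi n * op_entry A j n = q powi (j + i) * op_entry A j n"
    using arg_cong[OF assms(1), of "\<lambda>B. op_entry B j n"]
    by (simp add: op_entry_simps mult.assoc power_int_add mult.commute[of "q powi i"])
  then show ?thesis using assms(2) by simp
qed

lemma scalar_op_cancel: "c \<noteq> 0 \<Longrightarrow> scalar_op c * A = scalar_op c * B \<Longrightarrow> A = B"
proof -
  assume c: "c \<noteq> 0" and eq: "scalar_op c * A = scalar_op c * B"
  have "scalar_op (inverse c) * (scalar_op c * C) = C" for C
    using c by (simp add: mult.assoc[symmetric] scalar_op_mult[symmetric])
  then show "A = B" by (metis eq)
qed

text \<open>
  Conjugation by \<open>h\<close> grades the algebra, and an automorphism multiplies \<open>h\<close> by a scalar,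
  so it preserves the degrees of \<open>x\<close> and \<open>y\<close>. Applying it to \<open>h = 1 + (q - 1) x y\<close> then bounds
  the symbols.
\<close>

lemma weyl_ops_aut_generators:
  assumes R: "weyl_ops_aut R"
  obtains \<beta> where "\<beta> \<noteq> 0" "R (raise_op q) = scalar_op (inverse \<beta>) * raise_op q"
    "R shift_op = scalar_op \<beta> * shift_op"
proof -
  let ?X = "R (raise_op q)" and ?Y = "R shift_op"
  obtain c where c: "c \<noteq> 0" "R (diag_op q) = scalar_op c * diag_op q"
    using weyl_ops_aut_diag[OF R] by blast
  have mem: "?X \<in> weyl_ops" "?Y \<in> weyl_ops" by (simp_all add: weyl_ops_autD[OF R])
  obtain F G where F: "is_symbol ?Y F" and G: "is_symbol ?X G"
    using symbol_exists[OF mem(1)] symbol_exists[OF mem(2)] by blast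
  \<comment> \<open>The factor c in R(h) = c h occurs on both sides and cancels, so
    \<open>R A\<close> has the eigenvalue of A.\<close>
  have hom: "R A * diag_op q = scalar_op (q powi i) * diag_op q * R A"
    if "A \<in> weyl_ops" "A * diag_op q = diag_op q * (scalar_op (q powi i) * A)" for A i
  proof (rule scalar_op_cancel[OF c(1)])
    have "R (A * diag_op q) = R (diag_op q * (scalar_op (q powi i) * A))" using that by simp
    then have "R A * (scalar_op c * diag_op q) = scalar_op c * diag_op q * (scalar_op (q powi i) * R A)"
      using that(1) by (simp add: weyl_ops_autD[OF R] c(2))
    then show "scalar_op c * (R A * diag_op q) = scalar_op c * (scalar_op (q powi i) * diag_op q * R A)"
      by (metis mult.assoc scalar_op_commute)
  qed
  have Y: "op_entry ?Y j n = 0" if "n \<noteq> j + 1" for j n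
    by (rule op_entry_homogeneous[OF hom[OF _ _] that]) (simp_all add: shift_diag)
  have X: "op_entry ?X j n = 0" if "n \<noteq> j - 1" for j n
    by (rule op_entry_homogeneous[OF hom, of _ "- 1"])
      (use that in \<open>simp_all add: raise_diag power_int_minus\<close>)
  have Xj: "op_entry ?X j (j - 1) = poly (G (- 1)) (q powi j)" for j
    by (simp add: is_symbol_entry[OF G])
  have Yj: "op_entry ?Y j (j + 1) = poly (F 1) (q powi j)" for j
    by (simp add: is_symbol_entry[OF F])
  have G0: "G k = 0" if "k \<noteq> - 1" for k
  proof (rule poly_eq_powiI)
    fix j
    have "op_entry ?X j (j + k) = 0" using that by (intro X) simp
    then show "poly (G k) (q powi j) = poly 0 (q powi j)" by (simp add: is_symbol_entry[OF G])
  qed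
  have "R (diag_op q) = 1 + scalar_op (q - 1) * (?X * ?Y)"
    by (subst diag_eq) (simp add: weyl_ops_autD[OF R])
  then have XY: "scalar_op c * diag_op q = 1 + scalar_op (q - 1) * (?X * ?Y)"
    by (simp add: c)
  \<comment> \<open>Diagonal entries of c h = 1 + (q - 1) R(x) R(y).\<close>
  have key: "c * q powi j = 1 + (q - 1) * (poly (G (- 1)) (q powi j) * poly (F 1) (q powi (j - 1)))" for j
  proof -
    have "op_entry (?X * ?Y) j (j + 0) = poly (G (- 1)) (q powi j) * poly (F (0 - (- 1))) (q powi (j + - 1))"
      by (rule op_entry_mult_extreme[OF G F]) (use G0 in blast)
    moreover have "op_entry (scalar_op c * (diag_op q * 1)) j j = op_entry (1 + scalar_op (q - 1) * (?X * ?Y)) j j"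
      using XY by simp
    ultimately show ?thesis by (simp only: op_entry_simps) simp
  qed
  \<comment> \<open>By invariance of the sequences vanishing at nonnegative positions, the symbol of
    R(x) has the root 1; at \<open>j = 0\<close> the equation \<open>key\<close> then reads
    \<open>c = 1\<close>.\<close>
  have "op_entry ?X 0 (0 - 1) = 0" by (rule op_entry_preserve[OF mem(1)]) auto
  then have G1: "poly (G (- 1)) 1 = 0" by (simp only: Xj) simp
  then have "c = 1" using key[of 0] by simp
  define F' where "F' = pcompose (F 1) [:0, inverse q:]"
  have prod: "Polynomial.smult (q - 1) (G (- 1) * F') = [:- 1, 1:]"
  proof (rule poly_eq_powiI)
    fix j
    have "q powi j = 1 + (q - 1) * (poly (G (- 1)) (q powi j) * poly F' (q powi j))"
      using key[of j] \<open>c = 1\<close> by (simp add: F'_def poly_pcompose power_int_diff field_simps)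
    then have "(q - 1) * (poly (G (- 1)) (q powi j) * poly F' (q powi j)) = q powi j - 1"
      by (metis add_diff_cancel_left')
    then show "poly (Polynomial.smult (q - 1) (G (- 1) * F')) (q powi j) = poly [:- 1, 1:] (q powi j)"
      by simp
  qed
  then have nz: "G (- 1) \<noteq> 0" "F' \<noteq> 0" by auto
  \<comment> \<open>The degrees add up to 1, and the root 1 makes the symbol of R(x) nonconstant, so
    that of R(y) is constant.\<close>
  have "Polynomial.degree (G (- 1)) + Polynomial.degree F' = 1"
    using arg_cong[OF prod, of Polynomial.degree] nz by (simp add: degree_mult_eq)
  moreover have "Polynomial.degree (G (- 1)) \<noteq> 0"
  proof
    assume "Polynomial.degree (G (- 1)) = 0"
    then obtain a where "G (- 1) = [:a:]" by (rule degree_eq_zeroE)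
    then show False using G1 nz(1) by simp
  qed
  ultimately have "Polynomial.degree F' = 0" by simp
  then have "Polynomial.degree (F 1) = 0" by (simp add: F'_def degree_pcompose)
  then obtain \<beta> where \<beta>: "F 1 = [:\<beta>:]" by (rule degree_eq_zeroE)
  have "\<beta> \<noteq> 0" using nz(2) \<beta> by (auto simp: F'_def)
  have Gj: "poly (G (- 1)) (q powi j) = inverse \<beta> * ((q powi j - 1) / (q - 1))" for j
    using key[of j] \<open>c = 1\<close> \<open>\<beta> \<noteq> 0\<close> by (simp add: \<beta> field_simps)
  show ?thesis
  proof (rule that[OF \<open>\<beta> \<noteq> 0\<close>])
    show "?X = scalar_op (inverse \<beta>) * raise_op q"
    proof (rule weyl_ops_eqI)
      fix j n
      show "op_entry ?X j n = op_entry (scalar_op (inverse \<beta>) * raise_op q) j n"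
        by (cases "n = j - 1") (simp_all add: X Xj Gj op_entry_simps)
    qed (use mem in simp_all)
    show "?Y = scalar_op \<beta> * shift_op"
    proof (rule weyl_ops_eqI)
      fix j n
      show "op_entry ?Y j n = op_entry (scalar_op \<beta> * shift_op) j n"
        by (cases "n = j + 1") (simp_all add: Y Yj \<beta> op_entry_simps)
    qed (use mem in simp_all)
  qed
qed

end

section \<open>Conjugation by diagonal operators\<close>

definition conj_op :: "'k::field \<Rightarrow> 'k seq_op \<Rightarrow> 'k seq_op"
  where "conj_op \<beta> A = diag_op (inverse \<beta>) * A * diag_op \<beta>"

lemma diag_op_mult: "diag_op b * diag_op c = diag_op (b * c)"
  by (rule seq_op_eqI) (simp add: power_int_mult_distrib mult.assoc)

lemma diag_op_1 [simp]: "diag_op 1 = 1"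
  by (rule seq_op_eqI) simp

lemma conj_op_add: "conj_op \<beta> (A + B) = conj_op \<beta> A + conj_op \<beta> B"
  by (simp add: conj_op_def distrib_left distrib_right)

lemma conj_op_mult:
  assumes "\<beta> \<noteq> 0"
  shows "conj_op \<beta> (A * B) = conj_op \<beta> A * conj_op \<beta> B"
proof -
  have "conj_op \<beta> A * conj_op \<beta> B
      = diag_op (inverse \<beta>) * A * (diag_op \<beta> * diag_op (inverse \<beta>)) * B * diag_op \<beta>"
    by (simp only: conj_op_def mult.assoc)
  then show ?thesis using assms by (simp add: diag_op_mult conj_op_def mult.assoc)
qed

lemma conj_op_scalar:
  assumes "\<beta> \<noteq> 0"
  shows "conj_op \<beta> (scalar_op c) = scalar_op c"
proof -
  have "conj_op \<beta> (scalar_op c) = scalar_op c * (diag_op (inverse \<beta>) * diag_op \<beta>)"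
    by (simp only: conj_op_def scalar_op_commute[symmetric] mult.assoc)
  then show ?thesis using assms by (simp add: diag_op_mult)
qed

lemma conj_op_conj_op: "conj_op \<beta> (conj_op \<gamma> A) = conj_op (\<beta> * \<gamma>) A"
proof -
  have "conj_op \<beta> (conj_op \<gamma> A)
      = (diag_op (inverse \<beta>) * diag_op (inverse \<gamma>)) * A * (diag_op \<gamma> * diag_op \<beta>)"
    by (simp only: conj_op_def mult.assoc)
  then show ?thesis by (simp add: diag_op_mult conj_op_def mult.commute)
qed

lemma conj_op_1 [simp]: "conj_op 1 A = A"
  by (simp add: conj_op_def)

lemma conj_op_shift: "\<beta> \<noteq> 0 \<Longrightarrow> conj_op \<beta> shift_op = scalar_op \<beta> * shift_op"
  by (rule seq_op_eqI) (simp add: conj_op_def power_int_add power_int_inverse)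

lemma conj_op_raise: "\<beta> \<noteq> 0 \<Longrightarrow> conj_op \<beta> (raise_op q) = scalar_op (inverse \<beta>) * raise_op q"
proof (rule seq_op_eqI)
  fix u j assume "\<beta> \<noteq> 0"
  then have "inverse \<beta> powi j * \<beta> powi (j - 1) = inverse \<beta>"
    by (simp add: power_int_diff power_int_inverse field_simps)
  moreover have "seq_apply (conj_op \<beta> (raise_op q)) u j
      = (inverse \<beta> powi j * \<beta> powi (j - 1)) * ((q powi j - 1) / (q - 1) * u (j - 1))"
    by (simp add: conj_op_def)
  ultimately show "seq_apply (conj_op \<beta> (raise_op q)) u j
      = seq_apply (scalar_op (inverse \<beta>) * raise_op q) u j"
    by simp
qed

context q_generic
begin

text \<open>\<open>diag_op \<beta>\<close> itself need not lie in \<open>weyl_ops\<close>; closure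
  follows because conjugation scales the generators and respects sums and products.\<close>

lemma conj_op_closed:
  assumes "\<beta> \<noteq> 0" "A \<in> weyl_ops"
  shows "conj_op \<beta> A \<in> weyl_ops"
  using assms(2)
  by (induction rule: weyl_ops_induct)
    (simp_all add: conj_op_scalar conj_op_mult conj_op_add conj_op_raise conj_op_shift assms(1))

lemma weyl_ops_hom_eqI:
  assumes R: "\<And>A B. A \<in> weyl_ops \<Longrightarrow> B \<in> weyl_ops \<Longrightarrow> R (A + B) = R A + R B \<and> R (A * B) = R A * R B"
    and T: "\<And>A B. A \<in> weyl_ops \<Longrightarrow> B \<in> weyl_ops \<Longrightarrow> T (A + B) = T A + T B \<and> T (A * B) = T A * T B"
    and "\<And>c. R (scalar_op c) = T (scalar_op c)"
    and "R (raise_op q) = T (raise_op q)" "R shift_op = T shift_op" "A \<in> weyl_ops"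
  shows "R A = T A"
  using assms(6)
proof (induction rule: weyl_ops_induct)
  case (scalar c)
  show ?case by (rule assms(3))
next
  case (raise A)
  then show ?case using R[of "raise_op q" A] T[of "raise_op q" A] assms(4) by simp
next
  case (shift A)
  then show ?case using R[of shift_op A] T[of shift_op A] assms(5) by simp
next
  case (add A B)
  then show ?case using R[of A B] T[of A B] by simp
qed

lemma weyl_ops_aut_eq_conj_op:
  assumes R: "weyl_ops_aut R"
  obtains \<beta> where "\<beta> \<noteq> 0" "\<And>A. A \<in> weyl_ops \<Longrightarrow> R A = conj_op \<beta> A"
proof -
  obtain \<beta> where \<beta>: "\<beta> \<noteq> 0" "R (raise_op q) = scalar_op (inverse \<beta>) * raise_op q"
    "R shift_op = scalar_op \<beta> * shift_op"
    using weyl_ops_aut_generators[OF R] by blast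
  have "R A = conj_op \<beta> A" if "A \<in> weyl_ops" for A
    by (rule weyl_ops_hom_eqI[OF _ _ _ _ _ that])
      (simp_all add: weyl_ops_autD[OF R] conj_op_add conj_op_mult conj_op_scalar conj_op_raise
        conj_op_shift \<beta>)
  then show ?thesis using that \<beta>(1) by blast
qed

end

section \<open>Roots of unity\<close>

text \<open>If x has finite order, the order divides every element of N and hence the Gcd, even for
  infinite N. Otherwise N has no positive element, and its Gcd is 0.\<close>

lemma power_Gcd_eq_1:
  fixes x :: "'a::field"
  assumes "\<And>n. n \<in> N \<Longrightarrow> x ^ n = 1"
  shows "x ^ Gcd N = 1"
proof (cases "\<exists>n>0. x ^ n = 1")
  case True
  define r where "r = (LEAST n. n > 0 \<and> x ^ n = 1)"
  have r: "r > 0" "x ^ r = 1"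
    using LeastI_ex[OF True] by (simp_all add: r_def)
  have "r dvd n" if "x ^ n = 1" for n
  proof -
    have "x ^ (r * (n div r) + n mod r) = 1" using that by simp
    then have "x ^ (n mod r) = 1" by (simp only: power_add power_mult r(2)) simp
    then have "\<not> n mod r > 0"
      using not_less_Least[of "n mod r" "\<lambda>n. n > 0 \<and> x ^ n = 1"] r(1) by (simp add: r_def[symmetric])
    then show ?thesis by auto
  qed
  then have "r dvd Gcd N" using assms by (intro Gcd_greatest) auto
  then show ?thesis using r(2) by (auto simp: dvd_def power_mult)
next
  case False
  then have "N \<subseteq> {0}" using assms by auto
  then have "Gcd N = 0" by (simp add: Gcd_0_iff)
  then show ?thesis by (simp only: power_0)
qed

text \<open>A root of 1 + t + ... + t^(p-1) will do. It is not 1, because the value at 1 is p, which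
  is nonzero in characteristic zero.\<close>

lemma exists_prime_root_of_unity:
  assumes "Factorial_Ring.prime p"
  shows "\<exists>w :: 'a::{alg_closed_field, field_char_0}. w ^ p = 1 \<and> w \<noteq> 1"
proof -
  define P :: "'a poly" where "P = (\<Sum>i<p. Polynomial.monom 1 i)"
  have p: "p \<ge> 2" using assms by (rule prime_ge_2_nat)
  have "Polynomial.coeff P (p - 1) = (\<Sum>i<p. if i = p - 1 then 1 else 0)"
    by (simp add: P_def coeff_sum)
  also have "\<dots> = 1" using p by simp
  finally have "p - 1 \<le> Polynomial.degree P" by (intro le_degree) simp
  then have "Polynomial.degree P > 0" using p by linarith
  then obtain w where "poly P w = 0" using alg_closed_imp_poly_has_root by blast
  then have w: "(\<Sum>i<p. w ^ i) = 0" by (simp add: P_def poly_sum poly_monom)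
  have "w \<noteq> 1" using w p by auto
  moreover have "w ^ p - 1 = (w - 1) * (\<Sum>i<p. w ^ i)" by (rule power_diff_1_eq)
  ultimately show ?thesis using w by auto
qed

text \<open>Split off a prime, \<open>d = p * d'\<close>, with z of exact order d'. If p divides d',
  a p-th root of z has order d; otherwise z is multiplied by an element of order p.\<close>

lemma exists_primitive_root_of_unity:
  assumes "d > 0"
  shows "\<exists>z :: 'a::{alg_closed_field, field_char_0}. \<forall>m. z ^ m = 1 \<longleftrightarrow> d dvd m"
  using assms
proof (induction d rule: less_induct)
  case (less d)
  show ?case
  proof (cases "d = 1")
    case True
    then show ?thesis by (intro exI[of _ 1]) simp
  next
    case False
    then obtain p where p: "Factorial_Ring.prime p" "p dvd d" using prime_factor_nat by blast
    then obtain d' where d: "d = p * d'" by blast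
    have "d' < d" "d' > 0" using less.prems prime_gt_1_nat[OF p(1)] by (auto simp: d)
    then obtain z :: 'a where z: "\<And>m. z ^ m = 1 \<longleftrightarrow> d' dvd m" using less.IH by blast
    show ?thesis
    proof (cases "p dvd d'")
      case True
      obtain y where y: "y ^ p = z" using nth_root_exists[of p z] prime_gt_0_nat[OF p(1)] by blast
      have "y ^ m = 1 \<longleftrightarrow> d dvd m" for m
      proof
        assume m: "y ^ m = 1"
        \<comment> \<open>This gives only \<open>d' dvd m\<close>. Since p divides d', it yields
          \<open>m = p * m'\<close>, and a second use of z gives \<open>d' dvd m'\<close>.\<close>
        have "z ^ m = (y ^ m) ^ p" by (simp add: y[symmetric] power_mult[symmetric] mult.commute)
        then have "d' dvd m" using z m by simp
        then obtain m' where m': "m = p * m'" using True by (meson dvd_trans dvdE)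
        then have "z ^ m' = 1" using m y by (simp add: power_mult)
        then show "d dvd m" by (simp add: z d m')
      next
        assume "d dvd m"
        then obtain m' where "m = p * (d' * m')" by (auto simp: d dvd_def mult.assoc)
        then show "y ^ m = 1" by (simp add: power_mult[of y p] y z)
      qed
      then show ?thesis by blast
    next
      case False
      obtain w :: 'a where w: "w ^ p = 1" "w \<noteq> 1" using exists_prime_root_of_unity[OF p(1)] by blast
      have ord_w: "p dvd n" if "w ^ n = 1" for n
      proof (rule ccontr)
        assume "\<not> p dvd n"
        then have "Gcd {p, n} = 1" using p(1) by (simp add: prime_imp_coprime coprime_iff_gcd_eq_1[symmetric])
        then show False using power_Gcd_eq_1[of "{p, n}" w] w that by auto
      qed
      have "(z * w) ^ m = 1 \<longleftrightarrow> d dvd m" for m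
      proof
        assume m: "(z * w) ^ m = 1"
        \<comment> \<open>Raising to the power d' eliminates z and leaves a condition on w alone,
          from which p divides m.\<close>
        have "(z ^ d') ^ m * w ^ (d' * m) = ((z * w) ^ m) ^ d'"
          by (simp add: power_mult_distrib power_mult[symmetric] mult.commute)
        moreover have "z ^ d' = 1" by (simp add: z)
        ultimately have "w ^ (d' * m) = 1" using m by simp
        then have "p dvd m" using ord_w False p(1) by (metis prime_dvd_mult_iff)
        then have "w ^ m = 1" using w(1) by (auto simp: power_mult)
        then have "d' dvd m" using m z by (simp add: power_mult_distrib)
        then show "d dvd m"
          unfolding d using \<open>p dvd m\<close> False p(1) by (intro divides_mult) (auto intro: prime_imp_coprime)
      next
        assume "d dvd m"
        then have "d' dvd m" "p dvd m" by (auto simp: d dest: dvd_mult_left dvd_mult_right)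
        then have "z ^ m = 1" "w ^ m = 1" using w(1) by (auto simp: z power_mult)
        then show "(z * w) ^ m = 1" by (simp add: power_mult_distrib)
      qed
      then show ?thesis by blast
    qed
  qed
qed

text \<open>The d powers are distinct, and a polynomial of degree at most d has no more roots. The
  integer domain matches the carrier of \<open>integer_mod_group d\<close>.\<close>

lemma roots_of_unity_eq_powers:
  fixes z :: "'a::field"
  assumes "d > 0" "\<And>m. z ^ m = 1 \<longleftrightarrow> d dvd m"
  shows "bij_betw (\<lambda>k. z ^ nat k) {0..<int d} {x. x ^ d = 1}"
proof -
  let ?P = "Polynomial.monom 1 d - 1 :: 'a poly"
  have "Polynomial.coeff ?P d = 1" using assms(1) by simp
  then have P: "?P \<noteq> 0" by force
  have roots: "{x. poly ?P x = 0} = {x. x ^ d = 1}" by (simp add: poly_monom)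
  have "Polynomial.degree ?P \<le> d" by (intro degree_diff_le) (simp_all add: degree_monom_le)
  then have card: "finite {x :: 'a. x ^ d = 1}" "card {x :: 'a. x ^ d = 1} \<le> d"
    using poly_roots_finite[OF P] card_poly_roots_bound[OF P] unfolding roots by auto
  have z: "z \<noteq> 0" using assms(2)[of d] assms(1) by (auto simp: power_0_left)
  have eq: "i = j" if "i \<le> j" "j < d" "z ^ i = z ^ j" for i j
  proof -
    have "z ^ i * z ^ (j - i) = z ^ (i + (j - i))" by (simp only: power_add)
    then have "z ^ i * z ^ (j - i) = z ^ i" using that by simp
    then have "d dvd j - i" using z assms(2) by simp
    then show ?thesis using that by (auto dest: dvd_imp_le)
  qed
  have inj: "inj_on (\<lambda>k. z ^ nat k) {0..<int d}"
  proof (rule inj_onI)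
    fix i j assume ij: "i \<in> {0..<int d}" "j \<in> {0..<int d}" "z ^ nat i = z ^ nat j"
    then have "nat i < d" "nat j < d" by auto
    then have "nat i = nat j"
      using eq[of "nat i" "nat j"] eq[of "nat j" "nat i"] ij(3) by (metis nat_le_linear)
    then show "i = j" using ij by (simp add: eq_nat_nat_iff)
  qed
  have sub: "(\<lambda>k. z ^ nat k) ` {0..<int d} \<subseteq> {x. x ^ d = 1}"
  proof
    fix x assume "x \<in> (\<lambda>k. z ^ nat k) ` {0..<int d}"
    then obtain k where "x = z ^ nat k" by blast
    then have "x ^ d = z ^ (nat k * d)" by (simp only: power_mult)
    then show "x \<in> {x. x ^ d = 1}" by (simp add: assms(2))
  qed
  have "(\<lambda>k. z ^ nat k) ` {0..<int d} = {x. x ^ d = 1}"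
    by (rule card_seteq[OF card(1) sub]) (use card(2) card_image[OF inj] in simp)
  then show ?thesis using inj by (simp add: bij_betw_def)
qed

section \<open>The isotropy group\<close>

definition op_poly :: "'k::field poly \<Rightarrow> 'k seq_op \<Rightarrow> 'k seq_op"
  where "op_poly p A = (\<Sum>i\<le>Polynomial.degree p. scalar_op (Polynomial.coeff p i) * A ^ i)"

lemma scalar_op_power: "(scalar_op c * A) ^ n = scalar_op (c ^ n) * A ^ n"
proof (induction n)
  case (Suc n)
  have "(scalar_op c * A) ^ Suc n = scalar_op c * (A * scalar_op (c ^ n)) * A ^ n"
    by (simp add: Suc mult.assoc)
  then show ?case
    by (simp add: scalar_op_commute[of "c ^ n" A, symmetric] scalar_op_mult mult.assoc)
qed simp

lemma conj_op_power: "\<beta> \<noteq> 0 \<Longrightarrow> conj_op \<beta> (A ^ n) = conj_op \<beta> A ^ n"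
  using conj_op_scalar[of \<beta> 1] by (induction n) (simp_all add: conj_op_mult)

lemma conj_op_sum: "conj_op \<beta> (sum f I) = (\<Sum>i\<in>I. conj_op \<beta> (f i))"
  by (induction I rule: infinite_finite_induct) (simp_all add: conj_op_add, simp_all add: conj_op_def)

lemma conj_op_poly:
  assumes "\<beta> \<noteq> 0" "conj_op \<beta> A = scalar_op c * A"
  shows "conj_op \<beta> (op_poly p A)
    = (\<Sum>i\<le>Polynomial.degree p. scalar_op (Polynomial.coeff p i * c ^ i) * A ^ i)"
  using assms by (simp add: op_poly_def conj_op_sum conj_op_mult conj_op_scalar conj_op_power
      scalar_op_power scalar_op_mult mult.assoc)

lemma conj_op_diag: "\<beta> \<noteq> 0 \<Longrightarrow> conj_op \<beta> (diag_op c) = diag_op c"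
  by (simp add: conj_op_def diag_op_mult mult.commute[of _ \<beta>] mult.assoc[symmetric])

context q_generic
begin

text \<open>
  In both cases the sequence and the position are chosen such that only the \<open>n\<close>-th power
  contributes.
\<close>

lemma shift_poly_coeff:
  "seq_apply (\<Sum>i\<le>N. scalar_op (f i) * shift_op ^ i) (\<lambda>m. if m = int n then 1 else 0) 0
    = (if n \<le> N then f n else 0)"
proof -
  have "seq_apply (\<Sum>i\<le>N. scalar_op (f i) * shift_op ^ i) (\<lambda>m. if m = int n then 1 else 0) 0
    = (\<Sum>i\<le>N. f i * (if i = n then 1 else 0))"
    by (simp add: seq_apply_sum seq_apply_shift_power)
  also have "\<dots> = (\<Sum>i\<le>N. if i = n then f i else 0)"
    by (rule sum.cong) auto
  finally show ?thesis by simp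
qed

lemma raise_poly_coeff:
  "\<exists>c. c \<noteq> 0 \<and> (\<forall>f N. seq_apply (\<Sum>i\<le>N. scalar_op (f i) * raise_op q ^ i) (\<lambda>m. if m = 0 then 1 else 0) (int n)
    = (if n \<le> N then c * f n else 0))"
proof (intro exI conjI allI)
  let ?c = "\<Prod>l<n. (q powi (int n - int l) - 1) / (q - 1)"
  show "?c \<noteq> 0" by (auto simp: prod_zero_iff)
  fix f N
  have "seq_apply (\<Sum>i\<le>N. scalar_op (f i) * raise_op q ^ i) (\<lambda>m. if m = 0 then 1 else 0) (int n)
    = (\<Sum>i\<le>N. f i * ((\<Prod>l<i. (q powi (int n - int l) - 1) / (q - 1)) * (if n = i then 1 else 0)))"
    by (simp add: seq_apply_sum seq_apply_raise_power)
  also have "\<dots> = (\<Sum>i\<le>N. if i = n then ?c * f i else 0)"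
    by (rule sum.cong) auto
  finally show "seq_apply (\<Sum>i\<le>N. scalar_op (f i) * raise_op q ^ i) (\<lambda>m. if m = 0 then 1 else 0) (int n)
    = (if n \<le> N then ?c * f n else 0)" by simp
qed

lemma diag_power_cancel: "diag_op q ^ e * A = diag_op q ^ e * B \<longleftrightarrow> A = B"
  by (induction e) (simp_all add: mult.assoc diag_cancel)

text \<open>Conjugation fixes h and scales the n-th powers of y and x by \<open>\<beta> ^ n\<close>
  and its inverse. After cancelling the power of h, comparing n-th coefficients gives
  \<open>\<beta> ^ (n + 1) = 1\<close> wherever the coefficient is nonzero.\<close>

lemma conj_op_commutes_generators_iff:
  assumes \<beta>: "\<beta> \<noteq> 0"
  shows "conj_op \<beta> (diag_op q ^ e * op_poly b shift_op) = scalar_op (inverse \<beta>) * (diag_op q ^ e * op_poly b shift_op)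
      \<longleftrightarrow> (\<forall>n. Polynomial.coeff b n \<noteq> 0 \<longrightarrow> \<beta> ^ (n + 1) = 1)" (is "?lhs1 \<longleftrightarrow> ?rhs1")
    and "conj_op \<beta> (diag_op q ^ e * op_poly a (raise_op q)) = scalar_op \<beta> * (diag_op q ^ e * op_poly a (raise_op q))
      \<longleftrightarrow> (\<forall>n. Polynomial.coeff a n \<noteq> 0 \<longrightarrow> \<beta> ^ (n + 1) = 1)" (is "?lhs2 \<longleftrightarrow> ?rhs2")
proof -
  have swap: "scalar_op c * (diag_op q ^ e * A) = diag_op q ^ e * (scalar_op c * A)" for c A
    by (metis mult.assoc scalar_op_commute)
  have scale: "scalar_op c * op_poly p A = (\<Sum>i\<le>Polynomial.degree p. scalar_op (c * Polynomial.coeff p i) * A ^ i)" for c p A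
    by (simp add: op_poly_def sum_distrib_left scalar_op_mult mult.assoc)
  have conj: "conj_op \<beta> (diag_op q ^ e * op_poly p A) = diag_op q ^ e *
      (\<Sum>i\<le>Polynomial.degree p. scalar_op (Polynomial.coeff p i * c ^ i) * A ^ i)"
    if "conj_op \<beta> A = scalar_op c * A" for c p A
    by (simp add: conj_op_mult \<beta> conj_op_power conj_op_diag conj_op_poly[OF \<beta> that])
  have coeff1: "Polynomial.coeff b n * \<beta> ^ n = inverse \<beta> * Polynomial.coeff b n
      \<longleftrightarrow> (Polynomial.coeff b n \<noteq> 0 \<longrightarrow> \<beta> ^ (n + 1) = 1)" for n
    using \<beta> by (auto simp: field_simps)
  have coeff2: "Polynomial.coeff a n * inverse \<beta> ^ n = \<beta> * Polynomial.coeff a n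
      \<longleftrightarrow> (Polynomial.coeff a n \<noteq> 0 \<longrightarrow> \<beta> ^ (n + 1) = 1)" for n
    using \<beta> by (auto simp: field_simps)
  have lhs1: "?lhs1 \<longleftrightarrow> (\<Sum>i\<le>Polynomial.degree b. scalar_op (Polynomial.coeff b i * \<beta> ^ i) * shift_op ^ i)
      = (\<Sum>i\<le>Polynomial.degree b. scalar_op (inverse \<beta> * Polynomial.coeff b i) * shift_op ^ i)"
    by (simp only: conj[OF conj_op_shift[OF \<beta>]] swap scale diag_power_cancel)
  have lhs2: "?lhs2 \<longleftrightarrow> (\<Sum>i\<le>Polynomial.degree a. scalar_op (Polynomial.coeff a i * inverse \<beta> ^ i) * raise_op q ^ i)
      = (\<Sum>i\<le>Polynomial.degree a. scalar_op (\<beta> * Polynomial.coeff a i) * raise_op q ^ i)"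
    by (simp only: conj[OF conj_op_raise[OF \<beta>]] swap scale diag_power_cancel)
  show "?lhs1 \<longleftrightarrow> ?rhs1"
  proof
    assume ?lhs1
    show ?rhs1
    proof (intro allI)
      fix n
      have "Polynomial.coeff b n * \<beta> ^ n = inverse \<beta> * Polynomial.coeff b n"
        using arg_cong[OF \<open>?lhs1\<close>[unfolded lhs1], of "\<lambda>A. seq_apply A (\<lambda>m. if m = int n then 1 else 0) 0"]
        by (cases "n \<le> Polynomial.degree b") (simp_all add: shift_poly_coeff coeff_eq_0)
      then show "Polynomial.coeff b n \<noteq> 0 \<longrightarrow> \<beta> ^ (n + 1) = 1" by (simp only: coeff1)
    qed
  next
    assume ?rhs1
    then have "Polynomial.coeff b n * \<beta> ^ n = inverse \<beta> * Polynomial.coeff b n" for n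
      using coeff1 by blast
    then show ?lhs1 by (simp only: lhs1)
  qed
  show "?lhs2 \<longleftrightarrow> ?rhs2"
  proof
    assume ?lhs2
    show ?rhs2
    proof (intro allI)
      fix n
      obtain c where c: "c \<noteq> 0" "\<And>f N. seq_apply (\<Sum>i\<le>N. scalar_op (f i) * raise_op q ^ i)
          (\<lambda>m. if m = 0 then 1 else 0) (int n) = (if n \<le> N then c * f n else 0)"
        using raise_poly_coeff[of n] by blast
      have "Polynomial.coeff a n * inverse \<beta> ^ n = \<beta> * Polynomial.coeff a n"
        using arg_cong[OF \<open>?lhs2\<close>[unfolded lhs2], of "\<lambda>A. seq_apply A (\<lambda>m. if m = 0 then 1 else 0) (int n)"] c(1)
        by (cases "n \<le> Polynomial.degree a") (simp_all add: c(2) coeff_eq_0)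
      then show "Polynomial.coeff a n \<noteq> 0 \<longrightarrow> \<beta> ^ (n + 1) = 1" by (simp only: coeff2)
    qed
  next
    assume ?rhs2
    then have "Polynomial.coeff a n * inverse \<beta> ^ n = \<beta> * Polynomial.coeff a n" for n
      using coeff2 by blast
    then show ?lhs2 by (simp only: lhs2)
  qed
qed

text \<open>By the twisted product rule the property passes to products, since the conjugations by
  \<beta> and s commute. On scalars D vanishes, because \<open>D 1 = D 1 + D 1\<close>.\<close>

lemma conj_op_commutes_derivation:
  assumes \<beta>: "\<beta> \<noteq> 0" and s: "s \<noteq> 0"
    and closed: "\<And>A. A \<in> weyl_ops \<Longrightarrow> D A \<in> weyl_ops"
    and add: "\<And>A B. A \<in> weyl_ops \<Longrightarrow> B \<in> weyl_ops \<Longrightarrow> D (A + B) = D A + D B"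
    and scale: "\<And>c A. A \<in> weyl_ops \<Longrightarrow> D (scalar_op c * A) = scalar_op c * D A"
    and mult: "\<And>A B. A \<in> weyl_ops \<Longrightarrow> B \<in> weyl_ops \<Longrightarrow> D (A * B) = D A * B + conj_op s A * D B"
    and X: "conj_op \<beta> (D (raise_op q)) = D (conj_op \<beta> (raise_op q))"
    and Y: "conj_op \<beta> (D shift_op) = D (conj_op \<beta> shift_op)"
    and A: "A \<in> weyl_ops"
  shows "conj_op \<beta> (D A) = D (conj_op \<beta> A)"
proof -
  have step: "conj_op \<beta> (D (B * A)) = D (conj_op \<beta> (B * A))"
    if "A \<in> weyl_ops" "B \<in> weyl_ops" "conj_op \<beta> (D A) = D (conj_op \<beta> A)"
      "conj_op \<beta> (D B) = D (conj_op \<beta> B)" for A B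
    using that \<beta> s by (simp add: mult conj_op_add conj_op_mult conj_op_closed conj_op_conj_op mult.commute[of s])
  have "D 1 = D 1 + D 1"
    using mult[of 1 1] conj_op_scalar[OF s, of 1] by simp
  then have "D 1 = 0" by simp
  then have scalar: "D (scalar_op c) = 0" for c
    using scale[of 1 c] by simp
  show ?thesis
    using A
  proof (induction rule: weyl_ops_induct)
    case (scalar c)
    then show ?case using \<beta> by (simp add: conj_op_scalar \<open>\<And>c. D (scalar_op c) = 0\<close>) (simp add: conj_op_def)
  next
    case (raise A)
    then show ?case by (intro step X) simp_all
  next
    case (shift A)
    then show ?case by (intro step Y) simp_all
  next
    case (add A B)
    then show ?case using \<beta> by (simp add: assms(4) conj_op_add conj_op_closed)
  qed
qed


section \<open>Transfer between R and its operators\<close>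

definition weyl_op :: "'k free_algebra set \<Rightarrow> 'k seq_op"
  where "weyl_op r = weyl_rep q (SOME f. r = weyl_proj q f)"

text \<open>The representative chosen in \<open>weyl_op\<close> is immaterial: representatives of
  one coset act equally by \<open>weyl_rep_eq_iff\<close>.\<close>

lemma weyl_op_proj [simp]: "weyl_op (weyl_proj q f) = weyl_rep q f"
proof -
  have "weyl_proj q f = weyl_proj q (SOME g. weyl_proj q f = weyl_proj q g)"
    by (rule someI[of _ f]) simp
  then show ?thesis unfolding weyl_op_def by (metis weyl_rep_eq_iff)
qed

lemma weyl_op_bij: "bij_betw weyl_op (carrier (qweyl q)) weyl_ops"
proof (rule bij_betw_imageI)
  show "inj_on weyl_op (carrier (qweyl q))"
    by (rule inj_onI) (metis carrier_qweylE weyl_op_proj weyl_rep_eq_iff)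
  show "weyl_op ` carrier (qweyl q) = weyl_ops"
  proof
    show "weyl_op ` carrier (qweyl q) \<subseteq> weyl_ops"
      unfolding weyl_ops_def by (auto elim!: carrier_qweylE)
    show "weyl_ops \<subseteq> weyl_op ` carrier (qweyl q)"
      unfolding weyl_ops_def by (auto intro!: image_eqI[of _ _ "weyl_proj q _"])
  qed
qed

lemma weyl_op_eq_iff: "r \<in> carrier (qweyl q) \<Longrightarrow> s \<in> carrier (qweyl q) \<Longrightarrow> weyl_op r = weyl_op s \<longleftrightarrow> r = s"
  using weyl_op_bij by (auto simp: bij_betw_def inj_on_def)

lemma weyl_smult_closed [simp]: "r \<in> carrier (qweyl q) \<Longrightarrow> weyl_smult q c r \<in> carrier (qweyl q)"
proof -
  interpret Q: ring "qweyl q" by (rule ring_qweyl)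
  show "r \<in> carrier (qweyl q) \<Longrightarrow> weyl_smult q c r \<in> carrier (qweyl q)"
    by (simp add: weyl_smult_def)
qed

lemma weyl_op_simps:
  assumes "r \<in> carrier (qweyl q)"
  shows "weyl_op r \<in> weyl_ops"
    and "s \<in> carrier (qweyl q) \<Longrightarrow> weyl_op (r \<oplus>\<^bsub>qweyl q\<^esub> s) = weyl_op r + weyl_op s"
    and "s \<in> carrier (qweyl q) \<Longrightarrow> weyl_op (r \<otimes>\<^bsub>qweyl q\<^esub> s) = weyl_op r * weyl_op s"
    and "weyl_op (weyl_smult q c r) = scalar_op c * weyl_op r"
proof -
  show "weyl_op r \<in> weyl_ops" using assms weyl_op_bij by (meson bij_betwE)
  obtain f where f: "r = weyl_proj q f" using assms by (rule carrier_qweylE)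
  show "weyl_op (r \<oplus>\<^bsub>qweyl q\<^esub> s) = weyl_op r + weyl_op s" if s: "s \<in> carrier (qweyl q)"
    by (rule carrier_qweylE[OF s]) (simp add: f weyl_proj_add[symmetric] weyl_rep_add)
  show "weyl_op (r \<otimes>\<^bsub>qweyl q\<^esub> s) = weyl_op r * weyl_op s" if s: "s \<in> carrier (qweyl q)"
    by (rule carrier_qweylE[OF s]) (simp add: f weyl_proj_mult[symmetric] weyl_rep_mult)
  show "weyl_op (weyl_smult q c r) = scalar_op c * weyl_op r"
    by (simp add: f weyl_smult_def weyl_proj_mult[symmetric] weyl_rep_mult)
qed

lemma weyl_op_one: "weyl_op \<one>\<^bsub>qweyl q\<^esub> = 1"
  by (simp add: weyl_proj_one[symmetric])

lemma weyl_op_zero: "weyl_op \<zero>\<^bsub>qweyl q\<^esub> = 0"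
  by (simp add: weyl_proj_0[symmetric])

lemma weyl_gens_closed [simp]: "weyl_x q \<in> carrier (qweyl q)" "weyl_y q \<in> carrier (qweyl q)"
  by (simp_all add: weyl_x_def weyl_y_def)

lemma weyl_op_gens: "weyl_op (weyl_x q) = raise_op q" "weyl_op (weyl_y q) = shift_op"
  by (simp_all add: weyl_x_def weyl_y_def)

lemma weyl_h_closed: "weyl_h q \<in> carrier (qweyl q)"
proof -
  interpret Q: ring "qweyl q" by (rule ring_qweyl)
  show ?thesis by (simp add: weyl_h_def)
qed

lemma weyl_op_h: "weyl_op (weyl_h q) = diag_op q"
proof -
  interpret Q: ring "qweyl q" by (rule ring_qweyl)
  show ?thesis by (simp add: weyl_h_def weyl_op_simps weyl_op_one weyl_op_gens diag_eq)
qed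

lemma weyl_op_pow:
  assumes "r \<in> carrier (qweyl q)"
  shows "weyl_op (r [^]\<^bsub>qweyl q\<^esub> (n :: nat)) = weyl_op r ^ n"
proof -
  interpret Q: ring "qweyl q" by (rule ring_qweyl)
  show ?thesis
    using assms by (induction n) (simp_all add: weyl_op_simps weyl_op_one power_Suc2 del: power_Suc)
qed

lemma weyl_eval_closed: "r \<in> carrier (qweyl q) \<Longrightarrow> weyl_eval q p r \<in> carrier (qweyl q)"
proof -
  interpret Q: ring "qweyl q" by (rule ring_qweyl)
  show "r \<in> carrier (qweyl q) \<Longrightarrow> weyl_eval q p r \<in> carrier (qweyl q)"
    unfolding weyl_eval_def by (rule Q.finsum_closed) auto
qed

lemma weyl_op_eval:
  assumes r: "r \<in> carrier (qweyl q)"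
  shows "weyl_op (weyl_eval q p r) = op_poly p (weyl_op r)"
proof -
  interpret Q: ring "qweyl q" by (rule ring_qweyl)
  have "weyl_op (\<Oplus>\<^bsub>qweyl q\<^esub>i\<in>I. g i) = (\<Sum>i\<in>I. weyl_op (g i))"
    if "finite I" "g \<in> I \<rightarrow> carrier (qweyl q)" for I :: "nat set" and g
    using that
  proof (induction I rule: finite_induct)
    case (insert i I)
    then have "g i \<in> carrier (qweyl q)" "g \<in> I \<rightarrow> carrier (qweyl q)" by auto
    then show ?case using insert by (simp add: weyl_op_simps)
  qed (simp add: weyl_op_zero)
  from this[of "{..Polynomial.degree p}" "\<lambda>i. weyl_smult q (Polynomial.coeff p i) (r [^]\<^bsub>qweyl q\<^esub> i)"]
  show ?thesis
    using r by (simp add: weyl_eval_def op_poly_def weyl_op_simps weyl_op_pow)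
qed

definition weyl_of_op :: "'k seq_op \<Rightarrow> 'k free_algebra set"
  where "weyl_of_op = inv_into (carrier (qweyl q)) weyl_op"

lemma weyl_of_op_closed [simp]: "A \<in> weyl_ops \<Longrightarrow> weyl_of_op A \<in> carrier (qweyl q)"
  unfolding weyl_of_op_def by (meson bij_betwE bij_betw_inv_into weyl_op_bij)

lemma weyl_op_of_op [simp]: "A \<in> weyl_ops \<Longrightarrow> weyl_op (weyl_of_op A) = A"
  unfolding weyl_of_op_def by (rule bij_betw_inv_into_right[OF weyl_op_bij])

lemma weyl_of_op_op [simp]: "r \<in> carrier (qweyl q) \<Longrightarrow> weyl_of_op (weyl_op r) = r"
  unfolding weyl_of_op_def by (rule bij_betw_inv_into_left[OF weyl_op_bij])

lemma weyl_of_op_eqI: "r \<in> carrier (qweyl q) \<Longrightarrow> weyl_op r = A \<Longrightarrow> weyl_of_op A = r"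
  by auto

lemma weyl_of_op_simps:
  assumes "A \<in> weyl_ops"
  shows "B \<in> weyl_ops \<Longrightarrow> weyl_of_op (A + B) = weyl_of_op A \<oplus>\<^bsub>qweyl q\<^esub> weyl_of_op B"
    and "B \<in> weyl_ops \<Longrightarrow> weyl_of_op (A * B) = weyl_of_op A \<otimes>\<^bsub>qweyl q\<^esub> weyl_of_op B"
    and "weyl_of_op (scalar_op c * A) = weyl_smult q c (weyl_of_op A)"
proof -
  interpret Q: ring "qweyl q" by (rule ring_qweyl)
  show "B \<in> weyl_ops \<Longrightarrow> weyl_of_op (A + B) = weyl_of_op A \<oplus>\<^bsub>qweyl q\<^esub> weyl_of_op B"
    "B \<in> weyl_ops \<Longrightarrow> weyl_of_op (A * B) = weyl_of_op A \<otimes>\<^bsub>qweyl q\<^esub> weyl_of_op B"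
    "weyl_of_op (scalar_op c * A) = weyl_smult q c (weyl_of_op A)"
    using assms by (auto intro!: weyl_of_op_eqI simp: weyl_op_simps)
qed

lemma weyl_of_op_one: "weyl_of_op 1 = \<one>\<^bsub>qweyl q\<^esub>"
proof -
  interpret Q: ring "qweyl q" by (rule ring_qweyl)
  show ?thesis by (rule weyl_of_op_eqI) (simp_all add: weyl_op_one)
qed

text \<open>For nonzero \<beta> the automorphism multiplying x by the inverse of \<beta> and y by
  \<beta>, restricted to the carrier because the members of \<open>Bij\<close> are
  extensional.\<close>

definition weyl_scaling :: "'k \<Rightarrow> 'k free_algebra set \<Rightarrow> 'k free_algebra set"
  where "weyl_scaling \<beta> = (\<lambda>r\<in>carrier (qweyl q). weyl_of_op (conj_op \<beta> (weyl_op r)))"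

lemma weyl_scaling_closed:
  assumes "\<beta> \<noteq> 0" "r \<in> carrier (qweyl q)"
  shows "weyl_scaling \<beta> r \<in> carrier (qweyl q)"
    and "weyl_op (weyl_scaling \<beta> r) = conj_op \<beta> (weyl_op r)"
  using assms by (simp_all add: weyl_scaling_def conj_op_closed weyl_op_simps)

lemma weyl_scaling_aut:
  assumes "\<beta> \<noteq> 0"
  shows "weyl_scaling \<beta> \<in> weyl_Aut q"
proof -
  interpret Q: ring "qweyl q" by (rule ring_qweyl)
  note sc = weyl_scaling_closed[OF assms]
  have eqI: "r = s" if "r \<in> carrier (qweyl q)" "s \<in> carrier (qweyl q)" "weyl_op r = weyl_op s" for r s
    using that weyl_op_eq_iff by blast
  have "bij_betw (\<lambda>r. weyl_of_op (conj_op \<beta> (weyl_op r))) (carrier (qweyl q)) (carrier (qweyl q))"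
  proof (rule bij_betw_byWitness[of _ "\<lambda>r. weyl_of_op (conj_op (inverse \<beta>) (weyl_op r))"])
    show "\<forall>r\<in>carrier (qweyl q). weyl_of_op (conj_op (inverse \<beta>) (weyl_op (weyl_of_op (conj_op \<beta> (weyl_op r))))) = r"
      "\<forall>r\<in>carrier (qweyl q). weyl_of_op (conj_op \<beta> (weyl_op (weyl_of_op (conj_op (inverse \<beta>) (weyl_op r))))) = r"
      using assms by (simp_all add: conj_op_closed weyl_op_simps conj_op_conj_op)
  qed (use assms in \<open>auto simp: conj_op_closed weyl_op_simps\<close>)
  then have "bij_betw (weyl_scaling \<beta>) (carrier (qweyl q)) (carrier (qweyl q))"
    by (rule iffD1[OF bij_betw_cong, rotated]) (simp add: weyl_scaling_def)
  then have "weyl_scaling \<beta> \<in> Bij (carrier (qweyl q))"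
    by (simp add: Bij_def weyl_scaling_def)
  moreover have "weyl_scaling \<beta> \<in> ring_hom (qweyl q) (qweyl q)"
    by (rule ring_hom_memI; (rule eqI)?)
      (use assms in \<open>simp_all add: sc weyl_op_simps conj_op_mult conj_op_add weyl_op_one conj_op_scalar[of \<beta> 1, simplified]\<close>)
  moreover have "weyl_linear q (weyl_scaling \<beta>)"
    unfolding weyl_linear_def
    by (intro conjI ballI allI funcsetI; (rule eqI)?)
      (use assms in \<open>simp_all add: sc weyl_op_simps conj_op_mult conj_op_add conj_op_scalar\<close>)
  ultimately show ?thesis by (simp add: weyl_Aut_def)
qed

text \<open>Transported along \<open>weyl_op\<close>, \<rho> satisfies \<open>weyl_ops_aut\<close>
  and hence is a conjugation; extensionality turns agreement on the carrier into equality.\<close>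

lemma weyl_Aut_eq_scaling:
  assumes "\<rho> \<in> weyl_Aut q"
  obtains \<beta> where "\<beta> \<noteq> 0" "\<rho> = weyl_scaling \<beta>"
proof -
  interpret Q: ring "qweyl q" by (rule ring_qweyl)
  have bij: "bij_betw \<rho> (carrier (qweyl q)) (carrier (qweyl q))" and ext: "\<rho> \<in> extensional (carrier (qweyl q))"
    and hom: "\<rho> \<in> ring_hom (qweyl q) (qweyl q)" and lin: "weyl_linear q \<rho>"
    using assms by (auto simp: weyl_Aut_def Bij_def)
  have mem: "\<rho> r \<in> carrier (qweyl q)" if "r \<in> carrier (qweyl q)" for r
    by (rule ring_hom_closed[OF hom that])
  define R where "R = (\<lambda>A. weyl_op (\<rho> (weyl_of_op A)))"
  have "bij_betw (weyl_op \<circ> (\<rho> \<circ> weyl_of_op)) weyl_ops weyl_ops"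
    unfolding weyl_of_op_def
    by (intro bij_betw_trans[OF bij_betw_trans[OF bij_betw_inv_into[OF weyl_op_bij] bij] weyl_op_bij])
  then have "bij_betw R weyl_ops weyl_ops" by (simp add: R_def comp_def)
  moreover have "R (A + B) = R A + R B \<and> R (A * B) = R A * R B" if "A \<in> weyl_ops" "B \<in> weyl_ops" for A B
    using that by (simp add: R_def weyl_of_op_simps ring_hom_add[OF hom] ring_hom_mult[OF hom] weyl_op_simps mem)
  moreover have "R (scalar_op c) = scalar_op c" for c
  proof -
    have "\<rho> (weyl_smult q c \<one>\<^bsub>qweyl q\<^esub>) = weyl_smult q c \<one>\<^bsub>qweyl q\<^esub>"
      using lin ring_hom_one[OF hom] by (simp add: weyl_linear_def)
    moreover have "weyl_of_op (scalar_op c * 1) = weyl_smult q c \<one>\<^bsub>qweyl q\<^esub>"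
      by (simp only: weyl_of_op_simps(3) weyl_of_op_one weyl_ops_closed)
    ultimately show ?thesis by (simp add: R_def weyl_op_simps weyl_op_one)
  qed
  ultimately have "weyl_ops_aut R" by (simp add: weyl_ops_aut_def)
  then obtain \<beta> where \<beta>: "\<beta> \<noteq> 0" "\<And>A. A \<in> weyl_ops \<Longrightarrow> R A = conj_op \<beta> A"
    using weyl_ops_aut_eq_conj_op by blast
  have "\<rho> = weyl_scaling \<beta>"
  proof (rule extensionalityI[OF ext])
    show "weyl_scaling \<beta> \<in> extensional (carrier (qweyl q))" by (simp add: weyl_scaling_def)
    fix r assume r: "r \<in> carrier (qweyl q)"
    have "weyl_op (\<rho> r) = conj_op \<beta> (weyl_op r)"
      using \<beta>(2)[of "weyl_op r"] r by (simp add: R_def weyl_op_simps)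
    then show "\<rho> r = weyl_scaling \<beta> r"
      using r \<beta>(1) by (simp add: weyl_op_eq_iff[symmetric] mem weyl_scaling_closed)
  qed
  then show ?thesis using that \<beta>(1) by blast
qed

lemma weyl_scaling_inj:
  assumes "\<beta> \<noteq> 0" "\<gamma> \<noteq> 0" "weyl_scaling \<beta> = weyl_scaling \<gamma>"
  shows "\<beta> = \<gamma>"
proof -
  have "conj_op \<beta> shift_op = conj_op \<gamma> shift_op"
    using weyl_scaling_closed(2)[of \<beta> "weyl_y q"] weyl_scaling_closed(2)[of \<gamma> "weyl_y q"] assms
    by (simp add: weyl_op_gens)
  then have "op_entry (scalar_op \<beta> * shift_op) 0 1 = op_entry (scalar_op \<gamma> * shift_op) 0 1"
    using assms by (simp add: conj_op_shift)
  then show ?thesis by (simp add: op_entry_simps)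
qed

lemma weyl_scaling_compose:
  assumes "\<beta> \<noteq> 0" "\<gamma> \<noteq> 0"
  shows "compose (carrier (qweyl q)) (weyl_scaling \<beta>) (weyl_scaling \<gamma>) = weyl_scaling (\<beta> * \<gamma>)"
proof (rule extensionalityI)
  fix r assume r: "r \<in> carrier (qweyl q)"
  then show "compose (carrier (qweyl q)) (weyl_scaling \<beta>) (weyl_scaling \<gamma>) r = weyl_scaling (\<beta> * \<gamma>) r"
    using assms by (simp add: compose_eq weyl_op_eq_iff[symmetric] weyl_scaling_closed conj_op_conj_op)
qed (simp_all add: weyl_scaling_def)

text \<open>As \<sigma> is itself a scaling, \<delta> becomes a map D to which
  \<open>conj_op_commutes_derivation\<close> applies. Commuting can thus be tested on x and y, where
  the coefficient conditions arise.\<close>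

lemma weyl_scaling_isotropy_iff:
  fixes e :: nat
  assumes \<sigma>: "\<sigma> \<in> weyl_Aut q" and \<delta>: "weyl_derivation q \<sigma> \<delta>"
    and x: "\<delta> (weyl_x q) = weyl_h q [^]\<^bsub>qweyl q\<^esub> e \<otimes>\<^bsub>qweyl q\<^esub> weyl_eval q b (weyl_y q)"
    and y: "\<delta> (weyl_y q) = weyl_h q [^]\<^bsub>qweyl q\<^esub> e \<otimes>\<^bsub>qweyl q\<^esub> weyl_eval q a (weyl_x q)"
    and \<beta>: "\<beta> \<noteq> 0"
  shows "(\<forall>r\<in>carrier (qweyl q). weyl_scaling \<beta> (\<delta> r) = \<delta> (weyl_scaling \<beta> r)) \<longleftrightarrow>
    (\<forall>n. Polynomial.coeff a n \<noteq> 0 \<or> Polynomial.coeff b n \<noteq> 0 \<longrightarrow> \<beta> ^ (n + 1) = 1)"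
proof -
  interpret Q: ring "qweyl q" by (rule ring_qweyl)
  obtain s where s: "s \<noteq> 0" "\<sigma> = weyl_scaling s" using weyl_Aut_eq_scaling[OF \<sigma>] by blast
  have lin: "weyl_linear q \<delta>" using \<delta> by (simp add: weyl_derivation_def)
  have mem: "\<delta> r \<in> carrier (qweyl q)" if "r \<in> carrier (qweyl q)" for r
    using lin that by (auto simp: weyl_linear_def)
  define D where "D = (\<lambda>A. weyl_op (\<delta> (weyl_of_op A)))"
  have D_closed: "D A \<in> weyl_ops" if "A \<in> weyl_ops" for A
    using that by (simp add: D_def weyl_op_simps mem)
  have D_add: "D (A + B) = D A + D B" if "A \<in> weyl_ops" "B \<in> weyl_ops" for A B
    using that lin by (simp add: D_def weyl_of_op_simps weyl_linear_def weyl_op_simps mem)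
  have D_scale: "D (scalar_op c * A) = scalar_op c * D A" if "A \<in> weyl_ops" for c A
    using that lin by (simp add: D_def weyl_of_op_simps(3) weyl_linear_def weyl_op_simps mem)
  have D_mult: "D (A * B) = D A * B + conj_op s A * D B" if "A \<in> weyl_ops" "B \<in> weyl_ops" for A B
    using that \<delta> s by (simp add: D_def weyl_of_op_simps weyl_derivation_def weyl_op_simps mem weyl_scaling_closed)
  have D_x: "D (raise_op q) = diag_op q ^ e * op_poly b shift_op"
    using x weyl_of_op_op[of "weyl_x q"]
    by (simp add: D_def weyl_op_gens weyl_op_simps weyl_op_pow weyl_op_h weyl_h_closed weyl_eval_closed weyl_op_eval)
  have D_y: "D shift_op = diag_op q ^ e * op_poly a (raise_op q)"
    using y weyl_of_op_op[of "weyl_y q"]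
    by (simp add: D_def weyl_op_gens weyl_op_simps weyl_op_pow weyl_op_h weyl_h_closed weyl_eval_closed weyl_op_eval)
  have "weyl_scaling \<beta> (\<delta> r) = \<delta> (weyl_scaling \<beta> r) \<longleftrightarrow> conj_op \<beta> (D (weyl_op r)) = D (conj_op \<beta> (weyl_op r))"
    if "r \<in> carrier (qweyl q)" for r
  proof -
    have "conj_op \<beta> (D (weyl_op r)) = weyl_op (weyl_scaling \<beta> (\<delta> r))"
      using that \<beta> by (simp add: D_def weyl_scaling_closed mem)
    moreover have "D (conj_op \<beta> (weyl_op r)) = weyl_op (\<delta> (weyl_scaling \<beta> r))"
      using that by (simp add: D_def weyl_scaling_def)
    ultimately show ?thesis
      using that \<beta> by (simp add: weyl_op_eq_iff mem weyl_scaling_closed(1))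
  qed
  then have "(\<forall>r\<in>carrier (qweyl q). weyl_scaling \<beta> (\<delta> r) = \<delta> (weyl_scaling \<beta> r))
      \<longleftrightarrow> (\<forall>A\<in>weyl_op ` carrier (qweyl q). conj_op \<beta> (D A) = D (conj_op \<beta> A))"
    by simp
  also have "weyl_op ` carrier (qweyl q) = weyl_ops"
    by (rule bij_betw_imp_surj_on[OF weyl_op_bij])
  also have "(\<forall>A\<in>weyl_ops. conj_op \<beta> (D A) = D (conj_op \<beta> A))
      \<longleftrightarrow> conj_op \<beta> (D (raise_op q)) = D (conj_op \<beta> (raise_op q))
        \<and> conj_op \<beta> (D shift_op) = D (conj_op \<beta> shift_op)" (is "?all \<longleftrightarrow> ?gens")
  proof
    assume ?gens
    then show ?all
      using conj_op_commutes_derivation[OF \<beta> s(1) D_closed D_add D_scale D_mult] by simp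
  qed simp
  also have "\<dots> \<longleftrightarrow> (\<forall>n. Polynomial.coeff b n \<noteq> 0 \<longrightarrow> \<beta> ^ (n + 1) = 1) \<and>
      (\<forall>n. Polynomial.coeff a n \<noteq> 0 \<longrightarrow> \<beta> ^ (n + 1) = 1)"
    using conj_op_commutes_generators_iff(1)[OF \<beta>, of e b]
      conj_op_commutes_generators_iff(2)[OF \<beta>, of e a]
    by (simp only: conj_op_raise[OF \<beta>] conj_op_shift[OF \<beta>] D_scale weyl_ops_closed D_x D_y)
  finally show ?thesis by blast
qed

end

section \<open>The isotropy group as the group of d-th roots of unity\<close>

theorem proposition5:
  fixes q \<mu> :: "'k::{alg_closed_field, field_char_0}"
    and e d :: nat
    and a b :: "'k poly"
    and \<sigma> \<delta> :: "'k free_algebra set \<Rightarrow> 'k free_algebra set"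
  assumes "q \<noteq> 0"
    and "\<forall>n>0. q ^ n \<noteq> 1"
    and "\<mu> = q powi (1 - int e)"
    and "\<sigma> \<in> weyl_Aut q"
    and "\<sigma> (weyl_x q) = weyl_smult q (inverse \<mu>) (weyl_x q)"
    and "\<sigma> (weyl_y q) = weyl_smult q \<mu> (weyl_y q)"
    and "\<not> (a = 0 \<and> b = 0)"
    and "weyl_derivation q \<sigma> \<delta>"
    and "\<delta> (weyl_x q) = weyl_h q [^]\<^bsub>qweyl q\<^esub> e \<otimes>\<^bsub>qweyl q\<^esub> weyl_eval q b (weyl_y q)"
    and "\<delta> (weyl_y q) = weyl_h q [^]\<^bsub>qweyl q\<^esub> e \<otimes>\<^bsub>qweyl q\<^esub> weyl_eval q a (weyl_x q)"
    and "d = Gcd {k + 1 | k. Polynomial.coeff a k \<noteq> 0 \<or> Polynomial.coeff b k \<noteq> 0}"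
  shows "isotropy_group q \<delta> \<cong> integer_mod_group d"
proof -
  interpret q_generic q
    using assms(1,2) by unfold_locales auto
  let ?N = "{k + 1 | k. Polynomial.coeff a k \<noteq> 0 \<or> Polynomial.coeff b k \<noteq> 0}"
  let ?C = "carrier (qweyl q)"
  have "\<exists>k. Polynomial.coeff a k \<noteq> 0 \<or> Polynomial.coeff b k \<noteq> 0"
    using assms(7) by (auto simp: poly_eq_iff)
  then obtain k where "k + 1 \<in> ?N" by blast
  then have "d dvd k + 1" unfolding assms(11) by (rule Gcd_dvd)
  \<comment> \<open>Positivity matters: \<open>integer_mod_group 0\<close> is the group of all
    integers.\<close>
  then have d: "d > 0" by (intro gr0I) simp
  have root_iff: "(\<forall>n. Polynomial.coeff a n \<noteq> 0 \<or> Polynomial.coeff b n \<noteq> 0 \<longrightarrow> \<beta> ^ (n + 1) = 1)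
      \<longleftrightarrow> \<beta> ^ d = 1" for \<beta> :: 'k
  proof
    assume "\<forall>n. Polynomial.coeff a n \<noteq> 0 \<or> Polynomial.coeff b n \<noteq> 0 \<longrightarrow> \<beta> ^ (n + 1) = 1"
    then show "\<beta> ^ d = 1" unfolding assms(11) by (intro power_Gcd_eq_1) blast
  next
    assume \<beta>: "\<beta> ^ d = 1"
    show "\<forall>n. Polynomial.coeff a n \<noteq> 0 \<or> Polynomial.coeff b n \<noteq> 0 \<longrightarrow> \<beta> ^ (n + 1) = 1"
    proof (intro allI impI)
      fix n assume "Polynomial.coeff a n \<noteq> 0 \<or> Polynomial.coeff b n \<noteq> 0"
      then have "d dvd n + 1" unfolding assms(11) by (intro Gcd_dvd) blast
      then obtain m where "n + 1 = d * m" by blast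
      then show "\<beta> ^ (n + 1) = 1" by (simp only: power_mult \<beta> power_one)
    qed
  qed
  note iso_iff = weyl_scaling_isotropy_iff[OF assms(4,8,9,10), unfolded root_iff]
  have nz: "\<beta> \<noteq> 0" if "\<beta> ^ d = 1" for \<beta> :: 'k
    using that d by (auto simp: power_0_left)
  have carrier: "carrier (isotropy_group q \<delta>) = weyl_scaling ` {\<beta>. \<beta> ^ d = 1}"
  proof (rule Set.set_eqI)
    fix \<rho>
    show "\<rho> \<in> carrier (isotropy_group q \<delta>) \<longleftrightarrow> \<rho> \<in> weyl_scaling ` {\<beta>. \<beta> ^ d = 1}"
    proof
      assume "\<rho> \<in> carrier (isotropy_group q \<delta>)"
      then have \<rho>: "\<rho> \<in> weyl_Aut q" "\<forall>r\<in>?C. \<rho> (\<delta> r) = \<delta> (\<rho> r)"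
        by (simp_all add: isotropy_group_def)
      obtain \<beta> where \<beta>: "\<beta> \<noteq> 0" "\<rho> = weyl_scaling \<beta>" using weyl_Aut_eq_scaling[OF \<rho>(1)] by blast
      then show "\<rho> \<in> weyl_scaling ` {\<beta>. \<beta> ^ d = 1}" using \<rho>(2) iso_iff[OF \<beta>(1)] by blast
    next
      assume "\<rho> \<in> weyl_scaling ` {\<beta>. \<beta> ^ d = 1}"
      then obtain \<beta> where \<beta>: "\<beta> ^ d = 1" "\<rho> = weyl_scaling \<beta>" by blast
      then show "\<rho> \<in> carrier (isotropy_group q \<delta>)"
        using iso_iff[OF nz[OF \<beta>(1)]] weyl_scaling_aut[OF nz[OF \<beta>(1)]]
        by (simp add: isotropy_group_def)
    qed
  qed
  have mult: "weyl_scaling \<beta> \<otimes>\<^bsub>isotropy_group q \<delta>\<^esub> weyl_scaling \<gamma> = weyl_scaling (\<beta> * \<gamma>)"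
    if "\<beta> \<noteq> 0" "\<gamma> \<noteq> 0" for \<beta> \<gamma>
    using weyl_scaling_aut[OF that(1)] weyl_scaling_aut[OF that(2)] weyl_scaling_compose[OF that]
    by (simp add: isotropy_group_def BijGroup_def weyl_Aut_def)
  \<comment> \<open>A primitive d-th root of unity; its powers parametrize the carrier by the
    residues modulo d.\<close>
  obtain z :: 'k where z: "\<And>m. z ^ m = 1 \<longleftrightarrow> d dvd m"
    using exists_primitive_root_of_unity[OF d] by blast
  have zd: "z ^ d = 1" by (simp add: z)
  have z_mod: "z ^ (m mod d) = z ^ m" for m
  proof -
    have "z ^ m = z ^ (d * (m div d) + m mod d)" by simp
    also have "\<dots> = z ^ (m mod d)" by (simp only: power_add power_mult zd power_one mult_1_left)
    finally show ?thesis by simp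
  qed
  \<comment> \<open>The group operation of \<open>integer_mod_group d\<close> is addition reduced
    modulo d, which exponents of z do not notice.\<close>
  have z_add: "z ^ nat ((i + j) mod int d) = z ^ nat i * z ^ nat j" if "i \<ge> 0" "j \<ge> 0" for i j
    using that by (simp add: nat_mod_distrib nat_add_distrib z_mod power_add)
  let ?f = "\<lambda>i. weyl_scaling (z ^ nat i)"
  have "bij_betw (weyl_scaling \<circ> (\<lambda>i. z ^ nat i)) {0..<int d} (weyl_scaling ` {\<beta>. \<beta> ^ d = 1})"
    by (rule bij_betw_trans[OF roots_of_unity_eq_powers[OF d z]])
      (auto intro!: bij_betw_imageI inj_onI dest: nz weyl_scaling_inj)
  then have bij: "bij_betw ?f (carrier (integer_mod_group d)) (carrier (isotropy_group q \<delta>))"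
    using d by (simp add: carrier carrier_integer_mod_group comp_def)
  have "?f \<in> hom (integer_mod_group d) (isotropy_group q \<delta>)"
  proof (rule homI)
    fix i assume "i \<in> carrier (integer_mod_group d)"
    then show "?f i \<in> carrier (isotropy_group q \<delta>)" using bij by (meson bij_betwE)
  next
    fix i j assume "i \<in> carrier (integer_mod_group d)" "j \<in> carrier (integer_mod_group d)"
    then have "i \<ge> 0" "j \<ge> 0" using d by (simp_all add: carrier_integer_mod_group)
    moreover have "z \<noteq> 0" by (rule nz[OF zd])
    ultimately show "?f (i \<otimes>\<^bsub>integer_mod_group d\<^esub> j) = ?f i \<otimes>\<^bsub>isotropy_group q \<delta>\<^esub> ?f j"
      by (simp add: mult z_add)
  qed
  then have "integer_mod_group d \<cong> isotropy_group q \<delta>"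
    using bij by (auto simp: is_iso_def iso_def)
  then show ?thesis by (rule group.iso_sym[OF group_integer_mod_group])
qed

end
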